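(* Let $n\ge2$, let $\mu$ be a partition with at most $n$ parts, let $\rho=(n-1,n-2,\dots,1,0)$, and let $S_\lambda(x_1,\dots,x_n)$ denote the Schur polynomial. Then $$S_{2\mu+\rho}(1,q,q^2,\ldots,q^{n-1})=\Big(q^{\binom n3}(1+q)\,S_\mu(1,q^2,q^4,\ldots,q^{2n-2})\Big)\cdot w_1(q)\cdot w_2(q)\cdots w_{n-2}(q),$$ where $w_k(q)=(1+q)(1+q^2)\cdots(1+q^{k+1})$, and all $n-1$ factors on the right-hand side (the parenthesized factor and $w_1,\dots,w_{n-2}$) are symmetric unimodal polynomials in $q$.
   Context: A polynomial $f(q)=\sum_{i=N}^M a_iq^i$ is symmetric unimodal if $a_{N+i}=a_{M-i}$ for all $i$ and $a_N\le\cdots\le a_K\ge a_{K+1}\ge\cdots\ge a_M$ for some $K$. The partition $2\mu+\rho$ is $(2\mu_1+n-1,2\mu_2+n-2,\dots,2\mu_n)$. *)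

theory Defs
  imports "HOL-Computational_Algebra.Polynomial" "HOL-Library.FuncSet"
begin

text \<open>
  All indices are shifted to start at 0: a partition is an infinite weakly decreasing sequence
  with finite support, where \<open>\<mu> i\<close> is the part \<open>\<mu>\<^sub>i\<^sub>+\<^sub>1\<close>; likewise \<open>x i\<close> is the variable
  \<open>x\<^sub>i\<^sub>+\<^sub>1\<close>, and tableaux in \<open>n\<close> variables have entries in \<open>{0, \<dots>, n - 1}\<close>.
\<close>

definition is_partition :: "(nat \<Rightarrow> nat) \<Rightarrow> bool" where
  "is_partition \<mu> \<longleftrightarrow> antimono \<mu> \<and> finite {i. \<mu> i \<noteq> 0}"

definition num_parts :: "(nat \<Rightarrow> nat) \<Rightarrow> nat" where
  "num_parts \<mu> = card {i. \<mu> i \<noteq> 0}"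

text \<open>Natural-number subtraction truncates, so \<open>rho n i = 0\<close> for all \<open>i \<ge> n - 1\<close>.\<close>

definition rho :: "nat \<Rightarrow> nat \<Rightarrow> nat" where
  "rho n i = n - 1 - i"

definition cells :: "(nat \<Rightarrow> nat) \<Rightarrow> (nat \<times> nat) set" where
  "cells \<mu> = {(i, j). j < \<mu> i}"

definition ssyt :: "nat \<Rightarrow> (nat \<Rightarrow> nat) \<Rightarrow> (nat \<times> nat \<Rightarrow> nat) set" where
  "ssyt n \<mu> = {T \<in> cells \<mu> \<rightarrow>\<^sub>E {..<n}.
     (\<forall>i j j'. j < j' \<and> (i, j) \<in> cells \<mu> \<and> (i, j') \<in> cells \<mu> \<longrightarrow> T (i, j) \<le> T (i, j')) \<and>
     (\<forall>i i' j. i < i' \<and> (i, j) \<in> cells \<mu> \<and> (i', j) \<in> cells \<mu> \<longrightarrow> T (i, j) < T (i', j))}"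

text \<open>
  The value of the Schur polynomial in \<open>n\<close> variables at \<open>x 0, \<dots>, x (n - 1)\<close>, for points in an
  arbitrary commutative ring. Only partitions \<open>\<mu>\<close> are meaningful arguments.
\<close>

definition schur :: "nat \<Rightarrow> (nat \<Rightarrow> nat) \<Rightarrow> (nat \<Rightarrow> 'a::comm_ring_1) \<Rightarrow> 'a" where
  "schur n \<mu> x = (\<Sum>T\<in>ssyt n \<mu>. \<Prod>c\<in>cells \<mu>. x (T c))"

text \<open>The end coefficients \<open>a\<^sub>N\<close> and \<open>a\<^sub>M\<close> are not required to be nonzero.\<close>

definition symmetric_unimodal :: "'a::linordered_idom poly \<Rightarrow> bool" where
  "symmetric_unimodal f \<longleftrightarrow> (\<exists>N M. N \<le> M \<and>
     f = (\<Sum>i=N..M. monom (coeff f i) i) \<and>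
     (\<forall>i\<le>M - N. coeff f (N + i) = coeff f (M - i)) \<and>
     (\<exists>K. N \<le> K \<and> K \<le> M \<and>
        (\<forall>i. N \<le> i \<and> i < K \<longrightarrow> coeff f i \<le> coeff f (Suc i)) \<and>
        (\<forall>i. K \<le> i \<and> i < M \<longrightarrow> coeff f i \<ge> coeff f (Suc i))))"

abbreviation qvar :: "int poly" where
  "qvar \<equiv> [:0, 1:]"

definition w :: "nat \<Rightarrow> int poly" where
  "w k = (\<Prod>i=1..k+1. 1 + qvar ^ i)"

end

theory Submission
  imports Defs Complex_Main "Jordan_Normal_Form.Determinant"
begin

text \<open>
  By the bialternant formula, obtained here from the branching rule for tableaux, the numerator
  \<open>det (x\<^sub>i ^ (2 (\<mu> + \<rho>)\<^sub>j))\<close> of \<open>S\<close> at \<open>2\<mu> + \<rho>\<close> is the numerator of \<open>S\<^sub>\<mu>\<close> at the squared variables, so the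
  quotient is the product of all \<open>x\<^sub>i + x\<^sub>j\<close>; at \<open>x\<^sub>i = q ^ i\<close> these sums combine to \<open>q\<close>-powers and the \<open>w\<^sub>k\<close>.

  Unimodality comes from \<open>sl\<^sub>2\<close>. On the Gelfand-Tsetlin patterns with top row \<open>\<mu>\<close>, and on the subsets of
  \<open>{1, \<dots>, m}\<close> for the product of the \<open>1 + q ^ i\<close>, there is a weighted raising matrix \<open>X\<close> such that
  \<open>X X\<^sup>T - X\<^sup>T X\<close> is the diagonal matrix of the weights \<open>R - 2 deg\<close>. Hence \<open>X\<close> is injective below the middle degree
  and the level sizes increase there. For patterns the diagonal entries are computed by a
  Lagrange interpolation identity. The symmetry of the coefficients follows by complementation, which for tableaux
  uses that Schur polynomials are symmetric.
\<close>

section \<open>Raising matrices on graded sets\<close>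

text \<open>\<open>schur n \<mu>\<close> at the powers of \<open>q ^ 2\<close> has even exponents
  only, so in general it is not unimodal by itself. The product over pairs of variables contains
  \<open>w 0 = 1 + q\<close>; spending this factor here repeats every coefficient once and closes
  the gaps. What remains is unimodality in \<open>q ^ 2\<close>. The patterns index the
  Gelfand-Tsetlin basis of the irreducible representation of gl_n with highest weight
  \<open>\<mu>\<close>, and the degree is, up to an affine change, the weight for the principal
  sl_2. No representation has to be constructed: one commutator identity for one real matrix is all
  that enters. The entries of that matrix are square roots, but its commutator involves only squares
  on the diagonal and products around diamonds off it. All conditions can therefore be stated for
  the squared entries, which are rational functions of the pattern. The main computation is the
  diagonal, where the squared entries turn out to be residues.\<close>

lemma underdetermined_system:
  fixes M :: "'b \<Rightarrow> 'a \<Rightarrow> 'c::field"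
  assumes "finite B" "finite A" "card B < card A"
  shows "\<exists>x. (\<exists>a\<in>A. x a \<noteq> 0) \<and> (\<forall>b\<in>B. (\<Sum>a\<in>A. M b a * x a) = 0)"
  using assms
proof (induction B arbitrary: A M rule: finite_induct)
  case empty
  then have "A \<noteq> {}" by auto
  then show ?case by (intro exI[of _ "\<lambda>_. 1"]) auto
next
  case (insert b B)
  show ?case
  proof (cases "\<forall>a\<in>A. M b a = 0")
    case True
    have "card B < card A" using insert by auto
    from insert.IH[OF insert.prems(1) this, of M] True show ?thesis by auto
  next
    case False
    then obtain a0 where a0: "a0 \<in> A" "M b a0 \<noteq> 0" by auto
    define A' where "A' = A - {a0}"
    \<comment> \<open>Gaussian elimination with pivot \<open>M b a0\<close>: equation
      \<open>b\<close> is subtracted from the others, and the value at \<open>a0\<close> is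
      recovered from it in \<open>y\<close>.\<close>
    define c where "c e = M e a0 / M b a0" for e
    have fin: "finite A'" and card: "card B < card A'"
      using insert a0 by (auto simp: A'_def)
    obtain x where x: "\<exists>a\<in>A'. x a \<noteq> 0"
      "\<And>e. e \<in> B \<Longrightarrow> (\<Sum>a\<in>A'. (M e a - c e * M b a) * x a) = 0"
      using insert.IH[OF fin card, of "\<lambda>e a. M e a - c e * M b a"] by auto
    define y where "y = x(a0 := - (\<Sum>a\<in>A'. M b a * x a) / M b a0)"
    have split: "(\<Sum>a\<in>A. M e a * y a) = (\<Sum>a\<in>A'. M e a * x a) - c e * (\<Sum>a\<in>A'. M b a * x a)" for e
    proof -
      have "(\<Sum>a\<in>A. M e a * y a) = M e a0 * y a0 + (\<Sum>a\<in>A'. M e a * y a)"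
        unfolding A'_def by (rule sum.remove) (use a0 insert in auto)
      also have "(\<Sum>a\<in>A'. M e a * y a) = (\<Sum>a\<in>A'. M e a * x a)"
        by (rule sum.cong) (auto simp: y_def A'_def)
      finally show ?thesis by (simp add: y_def c_def)
    qed
    have "\<exists>a\<in>A. y a \<noteq> 0" using x(1) by (auto simp: y_def A'_def)
    moreover have "(\<Sum>a\<in>A. M e a * y a) = 0" if "e \<in> insert b B" for e
    proof (cases "e = b")
      case True
      then show ?thesis unfolding split using a0 by (simp add: c_def)
    next
      case False
      then have "(\<Sum>a\<in>A'. (M e a - c e * M b a) * x a) = 0" using x(2) that by auto
      then show ?thesis unfolding split
        by (simp add: algebra_simps sum_subtractf sum_distrib_left)
    qed
    ultimately show ?thesis by blast
  qed
qed

text \<open>If \<open>X\<close> raises the degree by one and \<open>X X\<^sup>T - X\<^sup>T X\<close> is diagonal with entries \<open>R - 2 d\<close>, then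
  \<open>|X x|\<^sup>2 = |X\<^sup>T x|\<^sup>2 + (R - 2 r) |x|\<^sup>2\<close> in degree \<open>r\<close>, so \<open>X\<close> is injective below the middle degree.\<close>

lemma card_level_mono_of_commutator:
  fixes X :: "'a \<Rightarrow> 'a \<Rightarrow> real" and d :: "'a \<Rightarrow> nat"
  assumes fin: "finite P"
    and deg: "\<And>g h. g \<in> P \<Longrightarrow> h \<in> P \<Longrightarrow> X g h \<noteq> 0 \<Longrightarrow> d h = Suc (d g)"
    and comm: "\<And>g h. g \<in> P \<Longrightarrow> h \<in> P \<Longrightarrow>
      (\<Sum>u\<in>P. X g u * X h u) - (\<Sum>u\<in>P. X u g * X u h) = (if g = h then real R - 2 * real (d g) else 0)"
    and r: "2 * r < R"
  shows "card {g \<in> P. d g = r} \<le> card {g \<in> P. d g = Suc r}"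
proof (rule ccontr)
  assume "\<not> ?thesis"
  then have "card {g \<in> P. d g = Suc r} < card {g \<in> P. d g = r}" by simp
  then obtain x where x: "\<exists>a\<in>{g \<in> P. d g = r}. x a \<noteq> 0"
     "\<And>u. u \<in> {g \<in> P. d g = Suc r} \<Longrightarrow> (\<Sum>g\<in>{g \<in> P. d g = r}. X g u * x g) = 0"
    using underdetermined_system[of "{g \<in> P. d g = Suc r}" "{g \<in> P. d g = r}" "\<lambda>u g. X g u"] fin
    by auto
  \<comment> \<open>Extending \<open>x\<close> by zero outside its level lets the sums run over all
    of \<open>P\<close>, where the commutator hypothesis applies.\<close>
  define y where "y g = (if d g = r then x g else 0)" for g
  have kill: "(\<Sum>g\<in>P. y g * X g u) = 0" if "u \<in> P" for u
  proof -
    have "(\<Sum>g\<in>P. y g * X g u) = (\<Sum>g\<in>{g \<in> P. d g = r}. X g u * x g)"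
      by (rule sum.mono_neutral_cong_right) (auto simp: fin y_def)
    also have "\<dots> = 0"
    proof (cases "d u = Suc r")
      case True then show ?thesis using x(2) that by simp
    next
      case False
      then have "X g u = 0" if "g \<in> P" "d g = r" for g using deg[of g u] that \<open>u \<in> P\<close> by auto
      then show ?thesis by simp
    qed
    finally show ?thesis .
  qed
  \<comment> \<open>The squared length of the image of \<open>y\<close> is a quadratic form in the
    Gram matrix; this is applied both to \<open>X\<close> and to its transpose.\<close>
  have quad: "(\<Sum>u\<in>P. (\<Sum>g\<in>P. y g * Y g u)\<^sup>2) = (\<Sum>g\<in>P. \<Sum>h\<in>P. y g * y h * (\<Sum>u\<in>P. Y g u * Y h u))"
    for Y :: "'a \<Rightarrow> 'a \<Rightarrow> real"
  proof -
    have "(\<Sum>u\<in>P. (\<Sum>g\<in>P. y g * Y g u)\<^sup>2) = (\<Sum>u\<in>P. \<Sum>g\<in>P. \<Sum>h\<in>P. y g * y h * (Y g u * Y h u))"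
      by (simp add: power2_eq_square sum_product mult_ac)
    also have "\<dots> = (\<Sum>g\<in>P. \<Sum>u\<in>P. \<Sum>h\<in>P. y g * y h * (Y g u * Y h u))"
      by (rule sum.swap)
    also have "\<dots> = (\<Sum>g\<in>P. \<Sum>h\<in>P. \<Sum>u\<in>P. y g * y h * (Y g u * Y h u))"
      by (intro sum.cong refl sum.swap)
    finally show ?thesis by (simp add: sum_distrib_left)
  qed
  have "0 = (\<Sum>u\<in>P. (\<Sum>g\<in>P. y g * X g u)\<^sup>2)" by (simp add: kill)
  also have "\<dots> = (\<Sum>u\<in>P. (\<Sum>g\<in>P. y g * X u g)\<^sup>2) +
     (\<Sum>g\<in>P. \<Sum>h\<in>P. y g * y h * ((\<Sum>u\<in>P. X g u * X h u) - (\<Sum>u\<in>P. X u g * X u h)))"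
    using quad[of X] quad[of "\<lambda>g u. X u g"] by (simp add: sum_subtractf algebra_simps)
  also have "(\<Sum>g\<in>P. \<Sum>h\<in>P. y g * y h * ((\<Sum>u\<in>P. X g u * X h u) - (\<Sum>u\<in>P. X u g * X u h)))
     = (\<Sum>g\<in>P. \<Sum>h\<in>P. if g = h then y g * y g * (real R - 2 * real (d g)) else 0)"
    by (intro sum.cong refl) (simp add: comm)
  also have "\<dots> = (\<Sum>g\<in>P. (y g)\<^sup>2 * (real R - 2 * real r))"
    by (intro sum.cong refl) (auto simp: fin y_def power2_eq_square)
  finally have eq: "0 = (\<Sum>u\<in>P. (\<Sum>g\<in>P. y g * X u g)\<^sup>2) + (\<Sum>g\<in>P. (y g)\<^sup>2 * (real R - 2 * real r))" .
  have pos: "real R - 2 * real r > 0" using r by linarith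
  obtain a where a: "a \<in> P" "y a \<noteq> 0" using x(1) by (auto simp: y_def)
  have "0 < (\<Sum>g\<in>P. (y g)\<^sup>2 * (real R - 2 * real r))"
    by (rule sum_pos2[OF fin a(1)]) (use a pos in auto)
  moreover have "0 \<le> (\<Sum>u\<in>P. (\<Sum>g\<in>P. y g * X u g)\<^sup>2)" by (simp add: sum_nonneg)
  ultimately show False using eq by linarith
qed

text \<open>Here \<open>m p g\<close> is the square of the matrix entry of the edge of colour \<open>p\<close> leaving \<open>g\<close>; the two
  paths around every diamond contribute equally, which kills the off-diagonal part of the commutator.\<close>

locale graded_diamonds =
  fixes P :: "'a set" and D :: "'p set" and E :: "'p \<Rightarrow> 'a \<Rightarrow> 'a \<Rightarrow> bool"
    and m :: "'p \<Rightarrow> 'a \<Rightarrow> real" and d :: "'a \<Rightarrow> nat" and R :: nat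
  assumes finP: "finite P" and finD: "finite D"
    and edge: "E p g h \<Longrightarrow> g \<in> P \<and> h \<in> P \<and> d h = Suc (d g)"
    and edge_fun: "E p g h \<Longrightarrow> E p g h' \<Longrightarrow> h = h'"
    and edge_inj: "E p g h \<Longrightarrow> E p g' h \<Longrightarrow> g = g'"
    and up_down: "E p g u \<Longrightarrow> E q h u \<Longrightarrow> p \<noteq> q \<Longrightarrow> \<exists>l. E q l g \<and> E p l h"
    and down_up: "E q l g \<Longrightarrow> E p l h \<Longrightarrow> p \<noteq> q \<Longrightarrow> \<exists>u. E p g u \<and> E q h u"
    and diamond: "E q l g \<Longrightarrow> E p l h \<Longrightarrow> p \<noteq> q \<Longrightarrow> m p g * m q h = m p l * m q l"
    and nonneg: "E p g h \<Longrightarrow> 0 \<le> m p g"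
    and diag: "g \<in> P \<Longrightarrow> (\<Sum>p\<in>D. \<Sum>u\<in>P. if E p g u then m p g else 0)
      - (\<Sum>p\<in>D. \<Sum>u\<in>P. if E p u g then m p u else 0) = real R - 2 * real (d g)"
begin

definition X :: "'a \<Rightarrow> 'a \<Rightarrow> real" where
  "X g h = (\<Sum>p\<in>D. if E p g h then sqrt (m p g) else 0)"

lemma X_commutator:
  assumes g: "g \<in> P" and h: "h \<in> P"
  shows "(\<Sum>u\<in>P. X g u * X h u) - (\<Sum>u\<in>P. X u g * X u h) = (if g = h then real R - 2 * real (d g) else 0)"
proof -
  \<comment> \<open>\<open>U\<close> collects the paths from \<open>g\<close> to \<open>h\<close>
    through an upper neighbour, \<open>L\<close> those through a lower one. The colours are crossed
    so that \<open>U p q\<close> and \<open>L p q\<close> are the two halves of the same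
    diamond.\<close>
  define U where "U p q = (\<Sum>u\<in>P. if E p g u \<and> E q h u then sqrt (m p g) * sqrt (m q h) else 0)" for p q
  define L where "L p q = (\<Sum>u\<in>P. if E q u g \<and> E p u h then sqrt (m q u) * sqrt (m p u) else 0)" for p q
  have "(\<Sum>u\<in>P. X g u * X h u) = (\<Sum>u\<in>P. \<Sum>p\<in>D. \<Sum>q\<in>D. if E p g u \<and> E q h u then sqrt (m p g) * sqrt (m q h) else 0)"
    unfolding X_def sum_product by (intro sum.cong refl) auto
  also have "\<dots> = (\<Sum>p\<in>D. \<Sum>u\<in>P. \<Sum>q\<in>D. if E p g u \<and> E q h u then sqrt (m p g) * sqrt (m q h) else 0)"
    by (rule sum.swap)
  also have "\<dots> = (\<Sum>p\<in>D. \<Sum>q\<in>D. U p q)"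
    unfolding U_def by (intro sum.cong refl sum.swap)
  finally have U: "(\<Sum>u\<in>P. X g u * X h u) = (\<Sum>p\<in>D. \<Sum>q\<in>D. U p q)" .
  have "(\<Sum>u\<in>P. X u g * X u h) = (\<Sum>u\<in>P. \<Sum>q\<in>D. \<Sum>p\<in>D. if E q u g \<and> E p u h then sqrt (m q u) * sqrt (m p u) else 0)"
    unfolding X_def sum_product by (intro sum.cong refl) auto
  also have "\<dots> = (\<Sum>q\<in>D. \<Sum>u\<in>P. \<Sum>p\<in>D. if E q u g \<and> E p u h then sqrt (m q u) * sqrt (m p u) else 0)"
    by (rule sum.swap)
  also have "\<dots> = (\<Sum>q\<in>D. \<Sum>p\<in>D. L p q)"
    unfolding L_def by (intro sum.cong refl sum.swap)
  also have "\<dots> = (\<Sum>p\<in>D. \<Sum>q\<in>D. L p q)" by (rule sum.swap)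
  finally have L: "(\<Sum>u\<in>P. X u g * X u h) = (\<Sum>p\<in>D. \<Sum>q\<in>D. L p q)" .
  have UL: "U p q = L p q" if pq: "p \<noteq> q" for p q
  proof (cases "\<exists>u. E p g u \<and> E q h u")
    case True
    then obtain u where u: "E p g u" "E q h u" by blast
    then obtain l where l: "E q l g" "E p l h" using up_down pq by blast
    have "U p q = (\<Sum>v\<in>P. if v = u then sqrt (m p g) * sqrt (m q h) else 0)"
      unfolding U_def by (intro sum.cong refl) (use u edge_fun in auto)
    also have "\<dots> = sqrt (m p g) * sqrt (m q h)" using edge[OF u(1)] by (simp add: finP)
    also have "\<dots> = sqrt (m q l) * sqrt (m p l)"
      by (simp only: diamond[OF l pq] real_sqrt_mult[symmetric] mult.commute)
    also have "\<dots> = (\<Sum>v\<in>P. if v = l then sqrt (m q l) * sqrt (m p l) else 0)"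
      using edge[OF l(1)] by (simp add: finP)
    also have "\<dots> = L p q"
      unfolding L_def by (intro sum.cong refl) (use l edge_inj in auto)
    finally show ?thesis .
  next
    case False
    then have "\<not> (E p g u \<and> E q h u)" "\<not> (E q l g \<and> E p l h)" for u l using down_up pq by blast+
    then have "U p q = 0" "L p q = 0" unfolding U_def L_def by (auto intro!: sum.neutral)
    then show ?thesis by simp
  qed
  have "(\<Sum>u\<in>P. X g u * X h u) - (\<Sum>u\<in>P. X u g * X u h) = (\<Sum>p\<in>D. \<Sum>q\<in>D. U p q - L p q)"
    by (simp add: U L sum_subtractf)
  also have "\<dots> = (\<Sum>p\<in>D. \<Sum>q\<in>D. if p = q then U p p - L p p else 0)"
    by (intro sum.cong refl) (auto simp: UL)
  also have "\<dots> = (\<Sum>p\<in>D. U p p - L p p)" by (simp add: finD)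
  also have "\<dots> = (if g = h then real R - 2 * real (d g) else 0)"
  proof (cases "g = h")
    case True
    have "U p p = (\<Sum>u\<in>P. if E p g u then m p g else 0)"
         "L p p = (\<Sum>u\<in>P. if E p u g then m p u else 0)" for p
      unfolding U_def L_def True[symmetric] by (auto intro!: sum.cong simp: nonneg)
    then show ?thesis using True diag[OF g] by (simp add: sum_subtractf)
  next
    case False
    then have "U p p = 0" "L p p = 0" for p
      unfolding U_def L_def using edge_inj edge_fun by (auto intro!: sum.neutral)
    then show ?thesis using False by simp
  qed
  finally show ?thesis .
qed

theorem card_level_mono: "2 * r < R \<Longrightarrow> card {g \<in> P. d g = r} \<le> card {g \<in> P. d g = Suc r}"
  by (rule card_level_mono_of_commutator[of P X d R, OF finP _ X_commutator])
    (auto simp: X_def dest: edge split: if_splits elim!: sum.not_neutral_contains_not_neutral)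

end

section \<open>Products of the factors \<open>1 + q ^ i\<close>\<close>

text \<open>A step replaces the element \<open>p\<close> by \<open>p + 1\<close>, where an element \<open>0\<close> is always available. The weights are
  those of the principal \<open>sl\<^sub>2\<close> in the spin representation of \<open>so\<^sub>2\<^sub>m\<^sub>+\<^sub>1\<close>.\<close>

definition subset_step :: "nat \<Rightarrow> nat \<Rightarrow> nat set \<Rightarrow> nat set \<Rightarrow> bool" where
  "subset_step m p S T \<longleftrightarrow> S \<subseteq> {1..m} \<and> p < m \<and> Suc p \<notin> S \<and> (p = 0 \<or> p \<in> S) \<and> T = insert (Suc p) (S - {p})"

definition subset_unstep :: "nat \<Rightarrow> nat set \<Rightarrow> nat set" where
  "subset_unstep p T = (if p = 0 then T - {Suc p} else insert p (T - {Suc p}))"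

text \<open>The values are forced by the diagonal condition. After summation by parts the indicator
  of \<open>p\<close> has coefficient \<open>subset_weight m p - subset_weight m (p - 1)\<close>,
  which must be \<open>- 2 p\<close>. The value at \<open>0\<close> must be the total degree
  \<open>R\<close>; it is half the generic formula because the step at \<open>0\<close> enters as
  \<open>1 - 2 * f 1\<close>.\<close>

definition subset_weight :: "nat \<Rightarrow> nat \<Rightarrow> real" where
  "subset_weight m p = (if p = 0 then real m * (real m + 1) / 2 else real m * (real m + 1) - real p * (real p + 1))"

lemma subset_step_iff:
  "subset_step m p S T \<longleftrightarrow> T \<subseteq> {1..m} \<and> p < m \<and> Suc p \<in> T \<and> p \<notin> T \<and> S = subset_unstep p T"
  unfolding subset_step_def subset_unstep_def by (auto simp: subset_iff)

text \<open>Summation by parts over a prefix. At \<open>k = m\<close> the boundary term is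
  \<open>2 * m * f m\<close>, which is the missing last summand of the degree.\<close>

lemma sum_subset_weight:
  assumes "0 < k"
  shows "(\<Sum>p<k. subset_weight m p * (if p = 0 then 1 - 2 * f 1 else f p - f (Suc p)))
     = real m * (real m + 1) / 2 - 2 * (\<Sum>i<k. real i * f i) - (real m * (real m + 1) - (real k - 1) * real k) * f k"
  using assms
proof (induction k rule: nat_induct_non_zero)
  case 1
  then show ?case by (simp add: subset_weight_def field_simps)
next
  case (Suc k)
  then show ?case by (simp add: subset_weight_def algebra_simps)
qed

lemma graded_diamonds_subsets:
  "graded_diamonds (Pow {1..m}) {..<m} (subset_step m) (\<lambda>p _. subset_weight m p) \<Sum> (\<Sum>{1..m})"
proof
  show "g \<in> Pow {1..m} \<and> h \<in> Pow {1..m} \<and> \<Sum>h = Suc (\<Sum>g)" if "subset_step m p g h" for p g h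
  proof -
    from that have g: "g \<subseteq> {1..m}" "p < m" "Suc p \<notin> g" "p = 0 \<or> p \<in> g" "h = insert (Suc p) (g - {p})"
      by (auto simp: subset_step_def)
    then have fin: "finite g" using finite_subset by blast
    have "\<Sum>g = p + \<Sum>(g - {p})"
    proof (cases "p \<in> g")
      case True
      then show ?thesis using fin by (simp add: sum.remove)
    next
      case False
      then show ?thesis using g(4) by simp
    qed
    then show ?thesis using g fin by auto
  qed
  show "h = h'" if "subset_step m p g h" "subset_step m p g h'" for p g h h'
    using that by (simp add: subset_step_def)
  show "g = g'" if "subset_step m p g h" "subset_step m p g' h" for p g h g'
    using that by (simp add: subset_step_iff)
  show "\<exists>l. subset_step m q l g \<and> subset_step m p l h"
    if "subset_step m p g u" "subset_step m q h u" "p \<noteq> q" for p g u q h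
  proof -
    have "subset_step m q (subset_unstep q g) g"
      using that unfolding subset_step_iff[of m q h] subset_step_def[of m p g] subset_step_iff[of m q _ g] by auto
    moreover have "subset_step m p (subset_unstep p h) h"
      using that unfolding subset_step_iff[of m p g] subset_step_def[of m q h] subset_step_iff[of m p _ h] by auto
    moreover have "subset_unstep q g = subset_unstep p h"
      using that unfolding subset_step_iff by (auto simp: subset_unstep_def split: if_splits)
    ultimately show ?thesis by metis
  qed
  show "\<exists>u. subset_step m p g u \<and> subset_step m q h u"
    if "subset_step m q l g" "subset_step m p l h" "p \<noteq> q" for q l g p h
  proof -
    have "subset_step m p g (insert (Suc p) (g - {p}))"
      using that unfolding subset_step_iff[of m q] subset_step_def by (auto simp: subset_step_def subset_unstep_def)
    moreover have "subset_step m q h (insert (Suc q) (h - {q}))"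
      using that unfolding subset_step_def by auto
    moreover have "insert (Suc q) (h - {q}) = insert (Suc p) (g - {p})"
      using that unfolding subset_step_def by auto
    ultimately show ?thesis by metis
  qed
  show "0 \<le> subset_weight m p" if "subset_step m p g h" for p g h
  proof -
    have "real p \<le> real m" using that by (simp add: subset_step_def)
    then have "real p * (real p + 1) \<le> real m * (real m + 1)" by (intro mult_mono) auto
    then show ?thesis by (simp add: subset_weight_def)
  qed
  show "(\<Sum>p\<in>{..<m}. \<Sum>u\<in>Pow {1..m}. if subset_step m p g u then subset_weight m p else 0)
      - (\<Sum>p\<in>{..<m}. \<Sum>u\<in>Pow {1..m}. if subset_step m p u g then subset_weight m p else 0)
      = real (\<Sum>{1..m}) - 2 * real (\<Sum>g)" if g: "g \<in> Pow {1..m}" for g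
  proof (cases "m = 0")
    case True
    then show ?thesis using g by simp
  next
    case False
    define f where "f i = (of_bool (i \<in> g) :: real)" for i
    have "0 \<notin> g" using g by auto
    have up: "(\<Sum>u\<in>Pow {1..m}. if subset_step m p g u then subset_weight m p else 0)
      = subset_weight m p * (1 - f (Suc p)) * (if p = 0 then 1 else f p)" if "p < m" for p
    proof -
      have "(\<Sum>u\<in>Pow {1..m}. if subset_step m p g u then subset_weight m p else 0)
        = (\<Sum>u\<in>Pow {1..m}. if u = insert (Suc p) (g - {p}) then
             (if Suc p \<notin> g \<and> (p = 0 \<or> p \<in> g) then subset_weight m p else 0) else 0)"
        using that g by (intro sum.cong refl) (auto simp: subset_step_def)
      also have "\<dots> = (if Suc p \<notin> g \<and> (p = 0 \<or> p \<in> g) then subset_weight m p else 0)"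
        using that g by (subst sum.delta) auto
      finally show ?thesis by (auto simp: f_def)
    qed
    have down: "(\<Sum>u\<in>Pow {1..m}. if subset_step m p u g then subset_weight m p else 0)
      = subset_weight m p * f (Suc p) * (1 - f p)" if "p < m" for p
    proof -
      have "(\<Sum>u\<in>Pow {1..m}. if subset_step m p u g then subset_weight m p else 0)
        = (\<Sum>u\<in>Pow {1..m}. if u = subset_unstep p g then
             (if Suc p \<in> g \<and> p \<notin> g then subset_weight m p else 0) else 0)"
        using that g by (intro sum.cong refl) (auto simp: subset_step_iff)
      also have "\<dots> = (if Suc p \<in> g \<and> p \<notin> g then subset_weight m p else 0)"
        using that g by (subst sum.delta) (auto simp: subset_unstep_def)
      finally show ?thesis by (auto simp: f_def)
    qed
    have "(\<Sum>p\<in>{..<m}. \<Sum>u\<in>Pow {1..m}. if subset_step m p g u then subset_weight m p else 0)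
      - (\<Sum>p\<in>{..<m}. \<Sum>u\<in>Pow {1..m}. if subset_step m p u g then subset_weight m p else 0)
      = (\<Sum>p<m. subset_weight m p * (if p = 0 then 1 - 2 * f 1 else f p - f (Suc p)))"
      using \<open>0 \<notin> g\<close> by (subst sum_subtractf[symmetric], intro sum.cong refl)
        (simp only: lessThan_iff up down, auto simp: f_def)
    also have "\<dots> = real m * (real m + 1) / 2 - 2 * (\<Sum>i<Suc m. real i * f i)"
      using False by (subst sum_subset_weight) (auto simp: algebra_simps)
    also have "(\<Sum>i<Suc m. real i * f i) = (\<Sum>i\<in>g. real i)"
      using g by (intro sum.mono_neutral_cong_right) (auto simp: f_def)
    also have "real m * (real m + 1) / 2 = real (\<Sum>{1..m})"
      using gauss_sum_from_Suc_0[of m, where 'a = nat] 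
      by (simp add: real_of_nat_div algebra_simps)
    finally show ?thesis by simp
  qed
qed auto

lemmas card_subset_level_mono = graded_diamonds.card_level_mono[OF graded_diamonds_subsets]

section \<open>Criteria for symmetric unimodality\<close>

text \<open>Growth is required below the middle only: the reflection of the coefficients turns it
  into decrease above the middle, so the peak may be put at \<open>(N + M) div 2\<close>.\<close>

lemma symmetric_unimodalI:
  fixes f :: "'a::linordered_idom poly"
  assumes "N \<le> M"
    and supp: "\<And>i. i < N \<or> M < i \<Longrightarrow> coeff f i = 0"
    and sym: "\<And>i. i \<le> M - N \<Longrightarrow> coeff f (N + i) = coeff f (M - i)"
    and mono: "\<And>i. N \<le> i \<Longrightarrow> 2 * i < N + M \<Longrightarrow> coeff f i \<le> coeff f (Suc i)"
  shows "symmetric_unimodal f"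
  unfolding symmetric_unimodal_def
proof (rule exI[of _ N], rule exI[of _ M], intro conjI)
  show "f = (\<Sum>i=N..M. monom (coeff f i) i)"
    using supp by (force simp: poly_eq_iff coeff_sum)
  show "\<exists>K. N \<le> K \<and> K \<le> M \<and> (\<forall>i. N \<le> i \<and> i < K \<longrightarrow> coeff f i \<le> coeff f (Suc i)) \<and>
     (\<forall>i. K \<le> i \<and> i < M \<longrightarrow> coeff f i \<ge> coeff f (Suc i))"
  proof (intro exI[of _ "(N + M) div 2"] conjI allI impI)
    fix i assume i: "(N + M) div 2 \<le> i \<and> i < M"
    \<comment> \<open>The mirror images of \<open>i\<close> and \<open>Suc i\<close> are
      \<open>Suc j\<close> and \<open>j\<close>.\<close>
    define j where "j = N + M - Suc i"
    have "coeff f i = coeff f (M - (M - i))" using i by simp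
    also have "\<dots> = coeff f (N + (M - i))" using i \<open>N \<le> M\<close> by (intro sym[symmetric]) linarith
    also have "N + (M - i) = Suc j" using i by (simp add: j_def Suc_diff_Suc)
    finally have 1: "coeff f i = coeff f (Suc j)" .
    have "coeff f (Suc i) = coeff f (M - (M - Suc i))" using i by simp
    also have "\<dots> = coeff f (N + (M - Suc i))" using i \<open>N \<le> M\<close> by (intro sym[symmetric]) linarith
    also have "N + (M - Suc i) = j" using i by (simp add: j_def)
    finally have 2: "coeff f (Suc i) = coeff f j" .
    show "coeff f i \<ge> coeff f (Suc i)" unfolding 1 2 using i by (intro mono) (auto simp: j_def)
  qed (use \<open>N \<le> M\<close> in \<open>auto intro!: mono\<close>)
qed (use assms in auto)

lemma qvar_power: "qvar ^ n = monom 1 n"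
  by (simp add: monom_altdef)

lemma coeff_sum_qvar_power:
  assumes "finite A"
  shows "coeff (\<Sum>a\<in>A. qvar ^ e a) r = int (card {a \<in> A. e a = r})"
proof -
  have "coeff (\<Sum>a\<in>A. qvar ^ e a) r = (\<Sum>a\<in>A. if e a = r then 1 else 0)"
    unfolding coeff_sum by (intro sum.cong refl) (simp only: qvar_power coeff_monom)
  also have "\<dots> = int (card {a \<in> A. e a = r})"
    using assms by (simp add: sum.If_cases Int_def)
  finally show ?thesis .
qed

lemma symmetric_unimodal_prod_one_plus_power:
  "symmetric_unimodal (\<Prod>i=1..m. 1 + qvar ^ i)"
proof -
  define f where "f = (\<Prod>i=1..m. 1 + qvar ^ i)"
  define R where "R = \<Sum>{1..m}"
  have "f = (\<Prod>i\<in>{1..m}. qvar ^ i + 1)" by (simp add: f_def add.commute)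
  also have "\<dots> = (\<Sum>S\<in>Pow {1..m}. (\<Prod>i\<in>S. qvar ^ i) * (\<Prod>i\<in>{1..m} - S. 1))"
    by (rule prod_add) simp
  also have "\<dots> = (\<Sum>S\<in>Pow {1..m}. qvar ^ \<Sum>S)"
    by (simp add: power_sum)
  finally have f: "coeff f r = int (card {S \<in> Pow {1..m}. \<Sum>S = r})" for r
    by (simp only: coeff_sum_qvar_power finite_Pow_iff finite_atLeastAtMost)
  have compl: "\<Sum>S + \<Sum>({1..m} - S) = R" if "S \<subseteq> {1..m}" for S
    unfolding R_def using sum.subset_diff[OF that finite_atLeastAtMost, of "\<lambda>i. i"] by (simp add: add.commute)
  show ?thesis unfolding f_def[symmetric]
  proof (rule symmetric_unimodalI[of 0 R])
    show "coeff f i = 0" if "i < 0 \<or> R < i" for i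
    proof -
      have "\<Sum>S \<noteq> i" if "S \<subseteq> {1..m}" for S using compl[OF that] \<open>i < 0 \<or> R < i\<close> by linarith
      then have "{S \<in> Pow {1..m}. \<Sum>S = i} = {}" by blast
      then show ?thesis by (simp only: f card.empty of_nat_0)
    qed
    show "coeff f (0 + i) = coeff f (R - i)" if "i \<le> R - 0" for i
    proof -
      have compl': "\<Sum>({1..m} - S) = R - \<Sum>S" if "S \<subseteq> {1..m}" for S
        using compl[OF that] by simp
      have "bij_betw (\<lambda>S. {1..m} - S) {S \<in> Pow {1..m}. \<Sum>S = i} {S \<in> Pow {1..m}. \<Sum>S = R - i}"
        by (rule bij_betw_byWitness[where f' = "\<lambda>S. {1..m} - S"])
          (use compl' that in \<open>auto simp: double_diff\<close>)
      from bij_betw_same_card[OF this] show ?thesis by (simp only: f add_0)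
    qed
    show "coeff f i \<le> coeff f (Suc i)" if "2 * i < 0 + R" for i
      using card_subset_level_mono[of i m] that unfolding f R_def by simp
  qed simp
qed

lemma symmetric_unimodal_w: "symmetric_unimodal (w k)"
  unfolding w_def by (rule symmetric_unimodal_prod_one_plus_power)

text \<open>Multiplying an even polynomial by \<open>1 + q\<close> makes each \<open>a r\<close>
  appear twice in a row, at \<open>2 r\<close> and \<open>2 r + 1\<close>. Symmetry and growth of
  \<open>a\<close> are inherited, with the centre now between two exponents.\<close>

lemma symmetric_unimodal_double:
  fixes a :: "nat \<Rightarrow> int" and f :: "int poly"
  assumes supp: "\<And>r. R < r \<Longrightarrow> a r = 0"
    and sym: "\<And>r. r \<le> R \<Longrightarrow> a r = a (R - r)"
    and mono: "\<And>r. 2 * r < R \<Longrightarrow> a r \<le> a (Suc r)"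
    and f: "\<And>r. coeff f r = (if even r then a (r div 2) else 0)"
  shows "symmetric_unimodal (qvar ^ c * (1 + qvar) * f)"
proof -
  define g where "g = qvar ^ c * (1 + qvar) * f"
  have "coeff ((1 + qvar) * f) i = a (i div 2)" for i
  proof (cases i)
    case 0
    then show ?thesis by (simp add: f algebra_simps)
  next
    case (Suc j)
    then show ?thesis by (simp add: f algebra_simps)
  qed
  moreover have "g = monom 1 c * ((1 + qvar) * f)"
    by (simp only: g_def qvar_power mult.assoc)
  ultimately have g: "coeff g i = (if i < c then 0 else a ((i - c) div 2))" for i
    by (simp only: coeff_monom_mult mult_1 not_less)
  show ?thesis unfolding g_def[symmetric]
  proof (rule symmetric_unimodalI[of c "c + 2 * R + 1"])
    show "coeff g i = 0" if "i < c \<or> c + 2 * R + 1 < i" for i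
      using that supp by (auto simp: g)
    show "coeff g (c + i) = coeff g (c + 2 * R + 1 - i)" if "i \<le> c + 2 * R + 1 - c" for i
    proof -
      have "(2 * R + 1 - i) div 2 = R - i div 2" using that by linarith
      moreover have "i div 2 \<le> R" using that by linarith
      moreover have "c + 2 * R + 1 - i - c = 2 * R + 1 - i" by simp
      ultimately show ?thesis using sym[of "i div 2"] that by (simp add: g)
    qed
    show "coeff g i \<le> coeff g (Suc i)" if "c \<le> i" "2 * i < c + (c + 2 * R + 1)" for i
    proof -
      define r where "r = (i - c) div 2"
      show ?thesis
      \<comment> \<open>An even offset stays inside a pair of equal coefficients; an odd one passes
        to the next pair.\<close>
      proof (cases "even (i - c)")
        case True
        then have "(Suc i - c) div 2 = r" unfolding r_def using that by (auto simp: Suc_diff_le)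
        then show ?thesis using that by (simp add: g r_def)
      next
        case False
        then have "(Suc i - c) div 2 = Suc r" unfolding r_def using that by (auto simp: Suc_diff_le)
        moreover have "i - c = 2 * r + 1" using odd_two_times_div_two_succ[OF False] by (simp only: r_def)
        then have "2 * r < R" using that by linarith
        ultimately show ?thesis using that(1) mono[of r] by (simp add: g r_def)
      qed
    qed
  qed simp
qed

section \<open>A Lagrange interpolation identity\<close>

text \<open>\<open>T J j\<close> is the residue at \<open>y j\<close> of the product of the
  \<open>(x - z i) / (x - y i)\<close>. The first claim is its partial fraction expansion, the
  second compares the coefficients of \<open>1 / x\<close> at infinity. They go through one
  induction together, since the residue at a new node \<open>y a\<close> is the old product
  evaluated there, hence given by the expansion.\<close>

lemma partial_fractions_Lagrange:
  fixes y z :: "'i \<Rightarrow> 'c::field"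
  assumes "finite J" "inj_on y J"
  defines "T \<equiv> \<lambda>J j. (y j - z j) * (\<Prod>i\<in>J - {j}. (y j - z i) / (y j - y i))"
  shows "\<And>x. x \<notin> y ` J \<Longrightarrow> (\<Prod>i\<in>J. (x - z i) / (x - y i)) = 1 + (\<Sum>j\<in>J. T J j / (x - y j))"
    and "(\<Sum>j\<in>J. T J j) = (\<Sum>j\<in>J. y j - z j)"
proof -
  from assms(1,2) have "(\<forall>x. x \<notin> y ` J \<longrightarrow> (\<Prod>i\<in>J. (x - z i) / (x - y i)) = 1 + (\<Sum>j\<in>J. T J j / (x - y j)))
    \<and> (\<Sum>j\<in>J. T J j) = (\<Sum>j\<in>J. y j - z j)"
  proof (induction J rule: finite_induct)
    case empty
    then show ?case by simp
  next
    case (insert a J)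
    then have pf: "\<And>x. x \<notin> y ` J \<Longrightarrow> (\<Prod>i\<in>J. (x - z i) / (x - y i)) = 1 + (\<Sum>j\<in>J. T J j / (x - y j))"
      and s: "(\<Sum>j\<in>J. T J j) = (\<Sum>j\<in>J. y j - z j)" by auto
    have a: "y a \<notin> y ` J" using insert by auto
    define \<delta> where "\<delta> = y a - z a"
    have Ta: "T (insert a J) a = \<delta> * (1 + (\<Sum>j\<in>J. T J j / (y a - y j)))"
      using insert.hyps pf[OF a] by (simp add: T_def \<delta>_def)
    have Tj: "T (insert a J) j = T J j + \<delta> * (T J j / (y j - y a))" if j: "j \<in> J" for j
    proof -
      have ne: "y j - y a \<noteq> 0" using a j by (metis imageI right_minus_eq)
      have "insert a J - {j} = insert a (J - {j})" using j insert.hyps by auto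
      then have "T (insert a J) j = T J j * ((y j - z a) / (y j - y a))"
        using insert.hyps by (simp add: T_def)
      also have "(y j - z a) / (y j - y a) = 1 + \<delta> / (y j - y a)"
        using ne by (simp add: \<delta>_def field_simps)
      finally show ?thesis by (simp add: algebra_simps)
    qed
    have swap: "(\<Sum>j\<in>J. T J j / (y j - y a)) = - (\<Sum>j\<in>J. T J j / (y a - y j))"
      unfolding sum_negf[symmetric] by (intro sum.cong refl) (metis minus_diff_eq divide_minus_right)
    have "(\<Sum>j\<in>insert a J. T (insert a J) j) = T (insert a J) a + (\<Sum>j\<in>J. T J j + \<delta> * (T J j / (y j - y a)))"
      using insert.hyps by (simp add: Tj)
    also have "\<dots> = \<delta> + (\<Sum>j\<in>J. T J j)"
      unfolding Ta sum.distrib sum_distrib_left[symmetric] swap by (simp add: algebra_simps)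
    also have "\<dots> = (\<Sum>j\<in>insert a J. y j - z j)"
      using insert.hyps by (simp add: s \<delta>_def)
    finally have 1: "(\<Sum>j\<in>insert a J. T (insert a J) j) = (\<Sum>j\<in>insert a J. y j - z j)" .
    have 2: "(\<Prod>i\<in>insert a J. (x - z i) / (x - y i)) = 1 + (\<Sum>j\<in>insert a J. T (insert a J) j / (x - y j))"
      if x: "x \<notin> y ` insert a J" for x
    proof -
      have xa: "x - y a \<noteq> 0" using x by auto
      \<comment> \<open>This splits a product of two simple poles,
        \<open>1 / ((x - y j) * (x - y a))\<close>, into single poles.\<close>
      have key: "T J j / (x - y j) + T J j / (x - y j) * (\<delta> / (x - y a))
         = (T J j + \<delta> * (T J j / (y j - y a))) / (x - y j) + \<delta> / (x - y a) * (T J j / (y a - y j))"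
        if j: "j \<in> J" for j
      proof -
        have ne: "y j - y a \<noteq> 0" "x - y j \<noteq> 0"
          using a j x by (metis imageI right_minus_eq, auto)
        have eq: "t / b + t / b * (\<delta> / c) = (t + \<delta> * (t / e)) / b + \<delta> / c * (t / - e)"
          if "b \<noteq> 0" "c \<noteq> 0" "e \<noteq> 0" "c = b + e" for t b c e :: 'c
          using that(1-3) unfolding that(4) by (simp add: divide_simps) (simp add: algebra_simps)
        show ?thesis using eq[OF ne(2) xa ne(1), of "T J j"] by (simp only: minus_diff_eq) simp
      qed
      have "(\<Prod>i\<in>insert a J. (x - z i) / (x - y i)) = (x - z a) / (x - y a) * (1 + (\<Sum>j\<in>J. T J j / (x - y j)))"
        using insert.hyps x by (simp add: pf)
      also have "(x - z a) / (x - y a) = 1 + \<delta> / (x - y a)"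
        using xa by (simp add: \<delta>_def field_simps)
      also have "(1 + \<delta> / (x - y a)) * (1 + (\<Sum>j\<in>J. T J j / (x - y j)))
         = 1 + \<delta> / (x - y a) + (\<Sum>j\<in>J. T J j / (x - y j) + T J j / (x - y j) * (\<delta> / (x - y a)))"
        unfolding sum.distrib sum_distrib_right[symmetric] by (simp only: ring_distribs mult_1 mult_1_right ac_simps)
      also have "(\<Sum>j\<in>J. T J j / (x - y j) + T J j / (x - y j) * (\<delta> / (x - y a)))
         = (\<Sum>j\<in>J. T (insert a J) j / (x - y j) + \<delta> / (x - y a) * (T J j / (y a - y j)))"
        by (intro sum.cong refl) (simp only: key Tj)
      also have "1 + \<delta> / (x - y a) + \<dots> = 1 + (\<delta> / (x - y a) * (1 + (\<Sum>j\<in>J. T J j / (y a - y j)))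
          + (\<Sum>j\<in>J. T (insert a J) j / (x - y j)))"
        unfolding sum.distrib sum_distrib_left[symmetric] by (simp only: ring_distribs mult_1 mult_1_right ac_simps)
      also have "\<dots> = 1 + (\<Sum>j\<in>insert a J. T (insert a J) j / (x - y j))"
        using insert.hyps by (simp add: Ta)
      finally show ?thesis .
    qed
    from 1 2 show ?case by blast
  qed
  then show "\<And>x. x \<notin> y ` J \<Longrightarrow> (\<Prod>i\<in>J. (x - z i) / (x - y i)) = 1 + (\<Sum>j\<in>J. T J j / (x - y j))"
    and "(\<Sum>j\<in>J. T J j) = (\<Sum>j\<in>J. y j - z j)" by blast+
qed

text \<open>A summand of the Lagrange identity for nodes \<open>s j, t j\<close> and numerator roots \<open>u j, v j\<close>. A degenerate
  gap \<open>s j = t j = u j = v j\<close> cancels from the rational function; its own summand is \<open>0/0 = 0\<close>.\<close>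

definition gap_term :: "'i set \<Rightarrow> ('i \<Rightarrow> real) \<Rightarrow> ('i \<Rightarrow> real) \<Rightarrow> ('i \<Rightarrow> real) \<Rightarrow> ('i \<Rightarrow> real) \<Rightarrow> 'i \<Rightarrow> real" where
  "gap_term J s t u v j = (t j - u j) * (t j - v j) / (t j - s j)
     * (\<Prod>i\<in>J - {j}. (t j - u i) * (t j - v i) / ((t j - s i) * (t j - t i)))"

lemma sum_gap_terms:
  fixes s t u v :: "'i \<Rightarrow> real"
  assumes fin: "finite J"
    and degen: "\<And>j. j \<in> J \<Longrightarrow> s j = t j \<Longrightarrow> u j = t j \<and> v j = t j"
    and dist: "\<And>i j. i \<in> J \<Longrightarrow> j \<in> J \<Longrightarrow> i \<noteq> j \<Longrightarrow> t i \<noteq> t j \<and> s i \<noteq> s j \<and> s i \<noteq> t j"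
  shows "(\<Sum>j\<in>J. gap_term J s t u v j + gap_term J t s u v j) = (\<Sum>j\<in>J. s j + t j - u j - v j)"
proof -
  \<comment> \<open>Only the nondegenerate gaps supply pairwise distinct nodes, as interpolation
    requires.\<close>
  define K where "K = {j \<in> J. s j \<noteq> t j}"
  have finK: "finite K" and KJ: "K \<subseteq> J" using fin by (auto simp: K_def)
  have red: "gap_term J s t u v j = gap_term K s t u v j" "gap_term J t s u v j = gap_term K t s u v j"
    if j: "j \<in> K" for j
  proof -
    have *: "i \<in> J - {j} - (K - {j}) \<Longrightarrow> (t j - u i) * (t j - v i) / ((t j - s i) * (t j - t i)) = 1" 
         "i \<in> J - {j} - (K - {j}) \<Longrightarrow> (s j - u i) * (s j - v i) / ((s j - t i) * (s j - s i)) = 1" for i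
      using degen[of i] dist[of i j] dist[of j i] j by (auto simp: K_def)
    show "gap_term J s t u v j = gap_term K s t u v j" "gap_term J t s u v j = gap_term K t s u v j"
      unfolding gap_term_def
      by ((intro arg_cong2[where f = "(*)"] refl prod.mono_neutral_right ballI,
          (use fin KJ in auto)[2], rule *, assumption)+)
  qed
  have zero: "gap_term J s t u v j = 0" "gap_term J t s u v j = 0" "s j + t j - u j - v j = 0" if "j \<in> J - K" for j
    using that degen by (auto simp: K_def gap_term_def)
  define y where "y p = (case p of (j, True) \<Rightarrow> t j | (j, False) \<Rightarrow> s j)" for p :: "'i \<times> bool"
  define z where "z p = (case p of (j, True) \<Rightarrow> u j | (j, False) \<Rightarrow> v j)" for p :: "'i \<times> bool"
  have inj: "inj_on y (K \<times> UNIV)"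
    using dist by (force simp: inj_on_def y_def K_def split: bool.splits)
  define T where "T p = (y p - z p) * (\<Prod>i\<in>K \<times> UNIV - {p}. (y p - z i) / (y p - y i))" for p
  have "(\<Sum>p\<in>K \<times> UNIV. T p) = (\<Sum>p\<in>K \<times> UNIV. y p - z p)"
    unfolding T_def using partial_fractions_Lagrange(2)[OF _ inj] finK by auto
  also have "(\<Sum>p\<in>K \<times> UNIV. T p) = (\<Sum>j\<in>K. gap_term K s t u v j + gap_term K t s u v j)"
  proof -
    have "T (j, True) = gap_term K s t u v j" "T (j, False) = gap_term K t s u v j" if j: "j \<in> K" for j
    proof -
      \<comment> \<open>Removing a node leaves its partner in the same gap and complete pairs in all
        others, which is the shape of \<open>gap_term\<close>.\<close>
      have *: "(\<Prod>i\<in>K \<times> UNIV - {(j,b)}. f i) = f (j, \<not> b) * (\<Prod>i\<in>K-{j}. f (i, True) * f (i, False))" 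
        for f :: "'i \<times> bool \<Rightarrow> real" and b
      proof -
        have "K \<times> UNIV - {(j,b)} = insert (j, \<not> b) ((K - {j}) \<times> UNIV)" using j by auto
        then have "(\<Prod>i\<in>K \<times> UNIV - {(j,b)}. f i) = f (j, \<not> b) * (\<Prod>i\<in>(K-{j}) \<times> UNIV. f i)"
          using finK by simp
        also have "(\<Prod>i\<in>(K-{j}) \<times> UNIV. f i) = (\<Prod>i\<in>K-{j}. \<Prod>b\<in>UNIV. f (i,b))"
          using finK by (simp add: prod.cartesian_product)
        finally show ?thesis by (simp add: UNIV_bool mult.commute)
      qed
      show "T (j, True) = gap_term K s t u v j" "T (j, False) = gap_term K t s u v j"
        unfolding T_def * gap_term_def by (simp_all add: y_def z_def mult_ac)
    qed
    moreover have "(\<Sum>p\<in>K \<times> UNIV. T p) = (\<Sum>j\<in>K. \<Sum>b\<in>UNIV. T (j,b))"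
      using finK by (simp add: sum.cartesian_product)
    ultimately show ?thesis by (simp add: UNIV_bool add.commute)
  qed
  also have "(\<Sum>p\<in>K \<times> UNIV. y p - z p) = (\<Sum>j\<in>K. \<Sum>b\<in>UNIV. y (j,b) - z (j,b))"
    using finK by (simp add: sum.cartesian_product)
  also have "\<dots> = (\<Sum>j\<in>K. s j + t j - u j - v j)"
    by (intro sum.cong refl) (simp add: UNIV_bool y_def z_def)
  also have "\<dots> = (\<Sum>j\<in>J. s j + t j - u j - v j)"
    by (rule sum.mono_neutral_left) (use fin KJ zero in auto)
  also have "(\<Sum>j\<in>K. gap_term K s t u v j + gap_term K t s u v j) = (\<Sum>j\<in>K. gap_term J s t u v j + gap_term J t s u v j)"
    by (simp add: red)
  also have "\<dots> = (\<Sum>j\<in>J. gap_term J s t u v j + gap_term J t s u v j)"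
    by (rule sum.mono_neutral_left) (use fin KJ zero in auto)
  finally show ?thesis .
qed

section \<open>Gelfand-Tsetlin patterns\<close>

text \<open>Up to sign and a constant this is the squared Gelfand-Tsetlin coefficient for raising entry \<open>i\<close> of the
  row \<open>l\<close>, where \<open>a\<close> is the longer and \<open>b\<close> the shorter neighbouring row. Viewed as a
  rational function, its zeros and poles are grouped below into gaps \<open>[l i, l (i - 1) - 1]\<close>, each
  containing \<open>a i\<close> and \<open>b (i - 1) - 1\<close>, together with one gap around infinity (index \<open>0\<close>).\<close>

definition row_prod :: "nat \<Rightarrow> (nat \<Rightarrow> real) \<Rightarrow> (nat \<Rightarrow> real) \<Rightarrow> (nat \<Rightarrow> real) \<Rightarrow> nat \<Rightarrow> real \<Rightarrow> real" where
  "row_prod k a b l i x = (\<Prod>j<Suc k. x - a j) * (\<Prod>j<k - 1. x + 1 - b j)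
     * (\<Prod>j\<in>{..<k} - {i}. inverse ((x - l j) * (x - l j + 1)))"

text \<open>The entries stand for shifted coordinates \<open>g (k, i) - i\<close>, so weak
  interlacing of the rows acquires offsets of one and the entries of row \<open>l\<close> become
  distinct.\<close>

locale interlacing_rows =
  fixes k :: nat and a b l :: "nat \<Rightarrow> real"
  assumes k: "0 < k"
    and l_le_a: "\<And>i. i < k \<Longrightarrow> l i \<le> a i"
    and a_le_l: "\<And>i. i < k \<Longrightarrow> a (Suc i) \<le> l i - 1"
    and b_le_l: "\<And>i. Suc i < k \<Longrightarrow> b i \<le> l i"
    and l_le_b: "\<And>i. Suc i < k \<Longrightarrow> l (Suc i) + 1 \<le> b i"
begin

text \<open>A cyclic shift matching the pole \<open>l i\<close> with the upper end
  \<open>s i\<close> of its gap. Gap \<open>0\<close> joins the highest pole \<open>l 0\<close> to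
  the lowest pole \<open>l (k - 1) - 1\<close> through infinity, and its two zeros are
  \<open>a 0\<close> and \<open>a k\<close>.\<close>

definition \<sigma> :: "nat \<Rightarrow> nat" where "\<sigma> i = (if i = 0 then k - 1 else i - 1)"
definition s :: "nat \<Rightarrow> real" where "s i = l (\<sigma> i) - 1"
definition v :: "nat \<Rightarrow> real" where "v i = (if i = 0 then a k else b (i - 1) - 1)"

lemma l_less: "i < j \<Longrightarrow> j < k \<Longrightarrow> l j + 1 \<le> l i"
proof (induction j)
  case (Suc j)
  have "l (Suc j) + 1 \<le> l j" using l_le_b[of j] b_le_l[of j] Suc by linarith
  then show ?case using Suc by (cases "i = j") auto
qed simp

lemma l_antimono: "i \<le> j \<Longrightarrow> j < k \<Longrightarrow> l j \<le> l i"
  using l_less[of i j] by (cases "i = j") auto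

lemma \<sigma>_bij: "bij_betw \<sigma> {..<k} {..<k}"
  by (rule bij_betw_byWitness[where f' = "\<lambda>i. if Suc i = k then 0 else Suc i"])
    (use k in \<open>auto simp: \<sigma>_def\<close>)

lemma \<sigma>_less: "j < k \<Longrightarrow> \<sigma> j < k"
  using k by (auto simp: \<sigma>_def)

lemma \<sigma>_bij': "j < k \<Longrightarrow> bij_betw \<sigma> ({..<k} - {j}) ({..<k} - {\<sigma> j})"
  using bij_betw_DiffI[OF \<sigma>_bij, of "{j}" "{\<sigma> j}"] \<sigma>_less by (simp add: bij_betw_def)

lemma gap:
  assumes "0 < i" "i < k"
  shows "l i \<le> a i" "a i \<le> s i" "l i \<le> v i" "v i \<le> s i"
  using assms l_le_a[of i] a_le_l[of "i - 1"] b_le_l[of "i - 1"] l_le_b[of "i - 1"]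
  by (auto simp: s_def v_def \<sigma>_def)

lemma gap0: "l 0 \<le> a 0" "v 0 \<le> s 0"
  using l_le_a[of 0] a_le_l[of "k - 1"] k by (auto simp: s_def v_def \<sigma>_def)

lemma s_less_l: "i < j \<Longrightarrow> j < k \<Longrightarrow> s j < l i"
proof -
  assume "i < j" "j < k"
  then have "l (j - 1) \<le> l i" by (intro l_antimono) auto
  then show ?thesis using \<open>i < j\<close> by (simp add: s_def \<sigma>_def)
qed

lemma s0_less_l: "i < k \<Longrightarrow> s 0 < l i"
proof -
  assume "i < k"
  then have "l (k - 1) \<le> l i" by (intro l_antimono) auto
  then show ?thesis by (simp add: s_def \<sigma>_def)
qed

lemma prod_uv: "(\<Prod>j<k. x - a j) * (\<Prod>j<k. x - v j) = (\<Prod>j<Suc k. x - a j) * (\<Prod>j<k - 1. x + 1 - b j)"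
proof -
  have "(\<Prod>j<k. f j) = f 0 * (\<Prod>j<k - 1. f (Suc j))" for f :: "nat \<Rightarrow> real"
    using k by (cases k) (simp_all only: prod.lessThan_Suc_shift diff_Suc_1)
  then have "(\<Prod>j<k. x - v j) = (x - a k) * (\<Prod>j<k - 1. x + 1 - b j)"
    by (simp add: v_def algebra_simps)
  then show ?thesis by simp
qed

lemma gap_term_l:
  assumes i: "i < k"
  shows "gap_term {..<k} s l a v i = row_prod k a b l i (l i)"
proof -
  let ?x = "l i"
  have prods: "f i * prod f ({..<k} - {i}) = prod f {..<k}" for f :: "nat \<Rightarrow> real"
    using i prod.remove[of "{..<k}" i f] by simp
  have "gap_term {..<k} s l a v i = ((?x - a i) * (\<Prod>j\<in>{..<k} - {i}. ?x - a j))
     * ((?x - v i) * (\<Prod>j\<in>{..<k} - {i}. ?x - v j))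
     * inverse ((?x - s i) * (\<Prod>j\<in>{..<k} - {i}. ?x - s j)) * (\<Prod>j\<in>{..<k} - {i}. inverse (?x - l j))"
    by (simp add: gap_term_def divide_inverse prod.distrib prod_inversef[symmetric] mult_ac)
  also have "\<dots> = ((\<Prod>j<k. ?x - a j) * (\<Prod>j<k. ?x - v j)) * inverse (\<Prod>j<k. ?x - s j)
      * (\<Prod>j\<in>{..<k} - {i}. inverse (?x - l j))"
    by (simp only: prods[of "\<lambda>j. ?x - a j"] prods[of "\<lambda>j. ?x - v j"] prods[of "\<lambda>j. ?x - s j"])
  also have "(\<Prod>j<k. ?x - s j) = (\<Prod>j<k. ?x - l j + 1)"
    unfolding s_def using prod.reindex_bij_betw[OF \<sigma>_bij, of "\<lambda>j. ?x - (l j - 1)"] by (simp add: algebra_simps)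
  \<comment> \<open>The factor at \<open>i\<close> is \<open>l i - l i + 1 = 1\<close>.\<close>
  also have "\<dots> = (\<Prod>j\<in>{..<k} - {i}. ?x - l j + 1)"
    using prods[of "\<lambda>j. ?x - l j + 1"] by simp
  finally show ?thesis
    unfolding prod_uv row_prod_def by (simp add: prod.distrib prod_inversef[symmetric] mult_ac)
qed

lemma gap_term_s:
  assumes i: "i < k"
  shows "gap_term {..<k} l s a v i = - row_prod k a b l (\<sigma> i) (l (\<sigma> i) - 1)"
proof -
  let ?x = "l (\<sigma> i) - 1"
  have x: "s i = ?x" by (simp add: s_def)
  have \<sigma>i: "\<sigma> i < k" using \<sigma>_less i by simp
  have prods: "f i * prod f ({..<k} - {i}) = prod f {..<k}" if "i < k" for i and f :: "nat \<Rightarrow> real"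
    using that prod.remove[of "{..<k}" i f] by simp
  have "gap_term {..<k} l s a v i = ((?x - a i) * (\<Prod>j\<in>{..<k} - {i}. ?x - a j))
     * ((?x - v i) * (\<Prod>j\<in>{..<k} - {i}. ?x - v j))
     * inverse ((?x - l i) * (\<Prod>j\<in>{..<k} - {i}. ?x - l j)) * (\<Prod>j\<in>{..<k} - {i}. inverse (?x - s j))"
    by (simp add: gap_term_def x divide_inverse prod.distrib prod_inversef[symmetric] mult_ac)
  also have "\<dots> = ((\<Prod>j<k. ?x - a j) * (\<Prod>j<k. ?x - v j)) * inverse (\<Prod>j<k. ?x - l j)
      * (\<Prod>j\<in>{..<k} - {i}. inverse (?x - s j))"
    by (simp only: prods[OF i, of "\<lambda>j. ?x - a j"] prods[OF i, of "\<lambda>j. ?x - v j"] prods[OF i, of "\<lambda>j. ?x - l j"])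
  also have "(\<Prod>j\<in>{..<k} - {i}. inverse (?x - s j)) = (\<Prod>j\<in>{..<k} - {\<sigma> i}. inverse (?x - l j + 1))"
    unfolding s_def using prod.reindex_bij_betw[OF \<sigma>_bij'[OF i], of "\<lambda>j. inverse (?x - (l j - 1))"]
    by (simp add: algebra_simps)
  \<comment> \<open>The factor at \<open>\<sigma> i\<close> is \<open>-1\<close>, the source of the
    sign in the claim.\<close>
  also have "(\<Prod>j<k. ?x - l j) = - (\<Prod>j\<in>{..<k} - {\<sigma> i}. ?x - l j)"
    using prods[OF \<sigma>i, of "\<lambda>j. ?x - l j"] by simp
  finally show ?thesis
    unfolding prod_uv row_prod_def by (simp add: prod.distrib prod_inversef[symmetric] mult_ac)
qed

text \<open>The summands are the residues at the poles \<open>l i\<close> and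
  \<open>l i - 1\<close>, and the sum of all residues is the sum of the poles minus the sum of the
  zeros.\<close>

lemma sum_row_prod:
  "(\<Sum>i<k. row_prod k a b l i (l i) - row_prod k a b l i (l i - 1))
    = (\<Sum>i<k. 2 * l i - 1) - (\<Sum>i<Suc k. a i) - (\<Sum>i<k - 1. b i - 1)"
proof -
  have "(\<Sum>i<k. row_prod k a b l i (l i) - row_prod k a b l i (l i - 1))
    = (\<Sum>i<k. row_prod k a b l i (l i)) - (\<Sum>i<k. row_prod k a b l (\<sigma> i) (l (\<sigma> i) - 1))"
    using sum.reindex_bij_betw[OF \<sigma>_bij, of "\<lambda>i. row_prod k a b l i (l i - 1)"] by (simp only: sum_subtractf)
  also have "\<dots> = (\<Sum>i<k. gap_term {..<k} s l a v i + gap_term {..<k} l s a v i)"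
    by (simp add: gap_term_l gap_term_s sum_subtractf)
  also have "\<dots> = (\<Sum>i<k. s i + l i - a i - v i)"
  proof (rule sum_gap_terms)
    \<comment> \<open>A gap of length zero squeezes its two zeros onto its end; gap \<open>0\<close>
      never degenerates because \<open>s 0 < l 0\<close>.\<close>
    show "a j = l j \<and> v j = l j" if "j \<in> {..<k}" "s j = l j" for j
      using that gap[of j] s0_less_l[of j] by (cases "j = 0") auto
    show "l i \<noteq> l j \<and> s i \<noteq> s j \<and> s i \<noteq> l j" if "i \<in> {..<k}" "j \<in> {..<k}" "i \<noteq> j" for i j
    proof -
      have ne: "l i \<noteq> l j" if "i < k" "j < k" "i \<noteq> j" for i j
        using l_less[of i j] l_less[of j i] that by (cases i j rule: linorder_cases) auto
      moreover have "\<sigma> i \<noteq> \<sigma> j" "\<sigma> i < k" "\<sigma> j < k"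
        using \<sigma>_bij that by (auto simp: bij_betw_def inj_on_def)
      ultimately have "s i \<noteq> s j" by (simp add: s_def)
      moreover have "s i \<noteq> l j"
      proof (cases "i < j")
        case True
        show ?thesis
        proof (cases "i = 0")
          case True then show ?thesis using s0_less_l[of j] that by auto
        next
          case False
          then show ?thesis using l_less[of i j] gap[of i] True that by auto
        qed
      next
        case False
        then show ?thesis using s_less_l[of j i] that by auto
      qed
      ultimately show ?thesis using ne that by auto
    qed
  qed simp
  also have "\<dots> = (\<Sum>i<k. s i) + (\<Sum>i<k. l i) - (\<Sum>i<k. a i) - (\<Sum>i<k. v i)"
    by (simp add: sum.distrib sum_subtractf)
  also have "(\<Sum>i<k. s i) = (\<Sum>i<k. l i - 1)"
    unfolding s_def by (rule sum.reindex_bij_betw[OF \<sigma>_bij])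
  also have "(\<Sum>i<k. v i) = a k + (\<Sum>i<k - 1. b i - 1)"
  proof -
    have "(\<Sum>j<k. f j) = f 0 + (\<Sum>j<k - 1. f (Suc j))" for f :: "nat \<Rightarrow> real"
      using k by (cases k) (simp_all only: sum.lessThan_Suc_shift diff_Suc_1)
    then show ?thesis by (simp add: v_def)
  qed
  finally show ?thesis by (simp add: sum.distrib sum_subtractf flip: sum_distrib_left)
qed

text \<open>The signs are controlled gap by gap. A gap with positive index
  \<open>j \<noteq> i\<close> lies on one side of \<open>l i\<close>, so its two zeros and two poles
  contribute a nonnegative quotient. For gap \<open>0\<close> the same follows by pairing
  \<open>a 0\<close> with \<open>l 0\<close> and \<open>v 0\<close> with \<open>s 0\<close>. The gap
  of \<open>i\<close> itself contributes the single nonpositive factor.\<close>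

lemma row_prod_nonpos:
  assumes i: "i < k"
  shows "row_prod k a b l i (l i) \<le> 0"
proof -
  have "0 \<le> (\<Prod>j\<in>{..<k} - {i}. (l i - a j) * (l i - v j) / ((l i - s j) * (l i - l j)))"
  proof (rule prod_nonneg)
    fix j assume j: "j \<in> {..<k} - {i}"
    consider "0 < j" "i < j" | "0 < j" "j < i" | "j = 0" using j by fastforce
    then show "0 \<le> (l i - a j) * (l i - v j) / ((l i - s j) * (l i - l j))"
    proof cases
      case 1
      then show ?thesis using gap[of j] s_less_l[of i j] j by (intro divide_nonneg_nonneg mult_nonneg_nonneg) auto
    next
      case 2
      then show ?thesis using gap[of j] l_less[of j i] i 
        by (intro divide_nonneg_nonneg mult_nonpos_nonpos) auto
    next
      case 3
      then have "(l i - a j) / (l i - l j) \<ge> 0" "(l i - v j) / (l i - s j) \<ge> 0"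
        using gap0 l_less[of j i] s0_less_l[of i] i j
        by (auto intro!: divide_nonneg_nonneg divide_nonpos_nonpos)
      from mult_nonneg_nonneg[OF this] show ?thesis by (simp add: mult.commute)
    qed
  qed
  moreover have "(l i - a i) * (l i - v i) / (l i - s i) \<le> 0"
  proof (cases "i = 0")
    case True
    then show ?thesis using gap0 s0_less_l[of 0] i
      by (intro divide_nonpos_nonneg mult_nonpos_nonneg) auto
  next
    case False
    then show ?thesis using gap[of i] i
      by (intro divide_nonneg_nonpos mult_nonpos_nonpos) auto
  qed
  ultimately show ?thesis
    unfolding gap_term_l[OF i, symmetric] gap_term_def by (rule mult_nonpos_nonneg[rotated])
qed

end

text \<open>A pattern lists its rows as \<open>g (k, 0), \<dots>, g (k, k - 1)\<close> for \<open>k \<le> n\<close>, padded by zeros, with top row \<open>\<mu>\<close>.\<close>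

definition gt_patterns :: "nat \<Rightarrow> (nat \<Rightarrow> nat) \<Rightarrow> (nat \<times> nat \<Rightarrow> nat) set" where
  "gt_patterns n \<mu> = {g. (\<forall>i. g (n, i) = \<mu> i) \<and> (\<forall>i. g (0, i) = 0) \<and> (\<forall>k>n. \<forall>i. g (k, i) = 0) \<and>
     (\<forall>k<n. \<forall>i. g (k, i) \<le> g (Suc k, i) \<and> g (Suc k, Suc i) \<le> g (k, i))}"

definition gt_degree :: "nat \<Rightarrow> (nat \<times> nat \<Rightarrow> nat) \<Rightarrow> nat" where
  "gt_degree n g = (\<Sum>k<n. \<Sum>i<k. g (k, i))"

definition gt_moves :: "nat \<Rightarrow> (nat \<times> nat) set" where
  "gt_moves n = (SIGMA k:{..<n}. {..<k})"

definition gt_step :: "nat \<Rightarrow> (nat \<Rightarrow> nat) \<Rightarrow> nat \<times> nat \<Rightarrow> (nat \<times> nat \<Rightarrow> nat) \<Rightarrow> (nat \<times> nat \<Rightarrow> nat) \<Rightarrow> bool" where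
  "gt_step n \<mu> p g h \<longleftrightarrow> p \<in> gt_moves n \<and> g \<in> gt_patterns n \<mu> \<and> h \<in> gt_patterns n \<mu> \<and> h = g(p := Suc (g p))"

text \<open>The weight of a move is the squared matrix coefficient in the Gelfand-Tsetlin basis of the raising
  operator of the principal \<open>sl\<^sub>2\<close>, written as a product of interactions between the moved entry and
  each other entry.\<close>

fun gt_factor :: "nat \<times> nat \<Rightarrow> nat \<times> nat \<Rightarrow> real \<Rightarrow> real \<Rightarrow> real" where
  "gt_factor (k, i) (k', j) x y =
     (if k' = Suc k then x - y else if k = Suc k' then x + 1 - y
      else if k = k' then inverse ((x - y) * (x - y + 1)) else 1)"

definition gt_coord :: "(nat \<times> nat \<Rightarrow> nat) \<Rightarrow> nat \<times> nat \<Rightarrow> real" where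
  "gt_coord g p = real (g p) - real (snd p)"

text \<open>The position \<open>x\<close> is kept apart from \<open>g\<close>:
  \<open>x = gt_coord g p\<close> gives the weight of the move leaving \<open>g\<close>, and one
  less gives that of the move arriving at \<open>g\<close>, as the product does not look at the
  entry \<open>p\<close>. The factor \<open>k (n - k)\<close> comes from the coefficient of the
  \<open>k\<close>-th simple root vector in the principal sl_2.\<close>

definition gt_weight_at :: "nat \<Rightarrow> nat \<times> nat \<Rightarrow> (nat \<times> nat \<Rightarrow> nat) \<Rightarrow> real \<Rightarrow> real" where
  "gt_weight_at n p g x = - (real (fst p) * (real n - real (fst p)))
     * (\<Prod>r\<in>(SIGMA k:{..n}. {..<k}) - {p}. gt_factor p r x (gt_coord g r))"

definition gt_weight :: "nat \<Rightarrow> nat \<times> nat \<Rightarrow> (nat \<times> nat \<Rightarrow> nat) \<Rightarrow> real" where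
  "gt_weight n p g = gt_weight_at n p g (gt_coord g p)"

lemma gt_patterns_zero:
  assumes "g \<in> gt_patterns n \<mu>" "k \<le> i"
  shows "g (k, i) = 0"
  using assms(2)
proof (induction k arbitrary: i)
  case 0
  then show ?case using assms by (simp add: gt_patterns_def)
next
  case (Suc k)
  then obtain j where j: "i = Suc j" "k \<le> j" by (cases i) auto
  show ?case
  proof (cases "k < n")
    case True
    then have "g (Suc k, Suc j) \<le> g (k, j)" using assms by (simp add: gt_patterns_def)
    then show ?thesis using Suc.IH[OF j(2)] j by simp
  next
    case False
    then show ?thesis using assms by (simp add: gt_patterns_def)
  qed
qed

lemma gt_patterns_le_top:
  assumes "g \<in> gt_patterns n \<mu>" "k \<le> n"
  shows "g (k, i) \<le> \<mu> i"
  using assms(2)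
proof (induction k rule: inc_induct)
  case base
  then show ?case using assms by (simp add: gt_patterns_def)
next
  case (step k)
  then have "g (k, i) \<le> g (Suc k, i)" using assms by (simp add: gt_patterns_def)
  then show ?case using step.IH by simp
qed

lemma finite_gt_patterns: "finite (gt_patterns n \<mu>)"
proof -
  define Q where "Q = (SIGMA k:{..n}. {..<k})"
  have "gt_patterns n \<mu> \<subseteq> {g. \<forall>p. (p \<in> Q \<longrightarrow> g p \<in> {..Max (\<mu> ` {..n})}) \<and> (p \<notin> Q \<longrightarrow> g p = 0)}"
  proof clarify
    fix g k i assume g: "g \<in> gt_patterns n \<mu>"
    show "((k, i) \<in> Q \<longrightarrow> g (k, i) \<in> {..Max (\<mu> ` {..n})}) \<and> ((k, i) \<notin> Q \<longrightarrow> g (k, i) = 0)"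
    proof (intro conjI impI)
      assume "(k, i) \<in> Q"
      then have "k \<le> n" "i \<le> n" by (auto simp: Q_def)
      then have "g (k, i) \<le> \<mu> i" "\<mu> i \<le> Max (\<mu> ` {..n})" using gt_patterns_le_top[OF g] by auto
      then show "g (k, i) \<in> {..Max (\<mu> ` {..n})}" by simp
    next
      assume "(k, i) \<notin> Q"
      then have "n < k \<or> k \<le> i" by (auto simp: Q_def)
      then show "g (k, i) = 0" using gt_patterns_zero[OF g] g by (auto simp: gt_patterns_def)
    qed
  qed
  moreover have "finite {g. \<forall>p. (p \<in> Q \<longrightarrow> g p \<in> {..Max (\<mu> ` {..n})}) \<and> (p \<notin> Q \<longrightarrow> g p = (0::nat))}"
    by (rule finite_set_of_finite_funs) (auto simp: Q_def)
  ultimately show ?thesis by (rule finite_subset)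
qed

text \<open>Patterns form a lattice under pointwise order; the fourth corner of a diamond of moves
  is the minimum or maximum of two opposite corners.\<close>

lemma gt_patterns_inf: "g \<in> gt_patterns n \<mu> \<Longrightarrow> h \<in> gt_patterns n \<mu> \<Longrightarrow> inf g h \<in> gt_patterns n \<mu>"
  unfolding gt_patterns_def by (auto simp: inf_nat_def simp del: min.bounded_iff intro!: min.mono)

lemma gt_patterns_sup: "g \<in> gt_patterns n \<mu> \<Longrightarrow> h \<in> gt_patterns n \<mu> \<Longrightarrow> sup g h \<in> gt_patterns n \<mu>"
  unfolding gt_patterns_def by (auto simp: sup_nat_def simp del: max.bounded_iff intro!: max.mono)

lemma gt_factor_swap:
  "p \<noteq> q \<Longrightarrow> gt_factor p q x (y + 1) * gt_factor q p y (x + 1) = gt_factor p q x y * gt_factor q p y x"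
proof (cases p; cases q)
  fix k i k' j assume "p \<noteq> q" and pq: "p = (k, i)" "q = (k', j)"
  have "inverse ((x - (y + 1)) * (x - (y + 1) + 1)) * inverse ((y - (x + 1)) * (y - (x + 1) + 1))
     = inverse ((x - y) * (x - y + 1)) * inverse ((y - x) * (y - x + 1))"
    unfolding inverse_mult_distrib[symmetric] by (rule arg_cong[of _ _ inverse]) (simp add: algebra_simps)
  then show ?thesis unfolding pq by (simp add: algebra_simps)
qed

text \<open>Going round a diamond changes only the mutual interaction of the two moved entries, and
  \<open>gt_factor_swap\<close> says that its two contributions balance.\<close>

lemma gt_weight_diamond:
  assumes "p \<noteq> q" "p \<in> gt_moves n" "q \<in> gt_moves n"
  shows "gt_weight n p (l(q := Suc (l q))) * gt_weight n q (l(p := Suc (l p))) = gt_weight n p l * gt_weight n q l"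
proof -
  let ?Q = "SIGMA k:{..n}. {..<k}"
  have mem: "p \<in> ?Q" "q \<in> ?Q" using assms by (auto simp: gt_moves_def)
  define c where "c p = - (real (fst p) * (real n - real (fst p)))" for p :: "nat \<times> nat"
  define A where "A p q = (\<Prod>r\<in>?Q - {p} - {q}. gt_factor p r (gt_coord l p) (gt_coord l r))" for p q
  have coord: "gt_coord (l(q := Suc (l q))) r = (if r = q then gt_coord l q + 1 else gt_coord l r)" for q r
    by (simp add: gt_coord_def)
  have w: "gt_weight n p l = c p * (gt_factor p q (gt_coord l p) (gt_coord l q) * A p q)"
    "gt_weight n p (l(q := Suc (l q))) = c p * (gt_factor p q (gt_coord l p) (gt_coord l q + 1) * A p q)"
    if "p \<noteq> q" "p \<in> ?Q" "q \<in> ?Q" for p q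
    using that
    by (auto simp: gt_weight_def gt_weight_at_def c_def A_def coord prod.remove[of "?Q - {p}" q])
  have "gt_weight n p (l(q := Suc (l q))) * gt_weight n q (l(p := Suc (l p)))
     = (c p * c q * A p q * A q p) * (gt_factor p q (gt_coord l p) (gt_coord l q + 1) * gt_factor q p (gt_coord l q) (gt_coord l p + 1))"
    using assms mem by (simp add: w(2)[of p q] w(2)[of q p])
  also have "\<dots> = gt_weight n p l * gt_weight n q l"
    unfolding gt_factor_swap[OF assms(1)] using assms mem by (simp add: w(1)[of p q] w(1)[of q p])
  finally show ?thesis .
qed

section \<open>Move weights expressed through three consecutive rows\<close>

lemma gt_weight_at_eq_row_prod:
  assumes "i < k" "k < n"
  shows "gt_weight_at n (k, i) g x = - (real k * (real n - real k)) *
    row_prod k (\<lambda>j. gt_coord g (Suc k, j)) (\<lambda>j. gt_coord g (k - 1, j)) (\<lambda>j. gt_coord g (k, j)) i x"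
proof -
  define F where "F k' j = (if (k', j) = (k, i) then 1 else gt_factor (k, i) (k', j) x (gt_coord g (k', j)))" for k' j
  have "(\<Prod>r\<in>(SIGMA k:{..n}. {..<k}) - {(k, i)}. gt_factor (k, i) r x (gt_coord g r))
     = (\<Prod>r\<in>(SIGMA k:{..n}. {..<k}). case r of (k', j) \<Rightarrow> F k' j)"
  proof (rule prod.mono_neutral_cong_left)
    show "\<forall>r\<in>(SIGMA k:{..n}. {..<k}) - ((SIGMA k:{..n}. {..<k}) - {(k, i)}). (case r of (k', j) \<Rightarrow> F k' j) = 1"
      by (auto simp: F_def)
    show "gt_factor (k, i) r x (gt_coord g r) = (case r of (k', j) \<Rightarrow> F k' j)"
      if "r \<in> (SIGMA k:{..n}. {..<k}) - {(k, i)}" for r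
      using that by (cases r) (auto simp: F_def simp del: gt_factor.simps)
  qed auto
  also have "\<dots> = (\<Prod>k'\<le>n. \<Prod>j<k'. F k' j)"
    by (subst prod.Sigma) auto
  also have "\<dots> = (\<Prod>k'\<in>{Suc k, k - 1, k}. \<Prod>j<k'. F k' j)"
  proof (rule prod.mono_neutral_right)
    have "F k' j = 1" if "k' \<notin> {Suc k, k - 1, k}" for k' j
      using that unfolding F_def gt_factor.simps by (cases "k = Suc k'") simp_all
    then show "\<forall>k'\<in>{..n} - {Suc k, k - 1, k}. (\<Prod>j<k'. F k' j) = 1" by simp
  qed (use assms in auto)
  also have "\<dots> = (\<Prod>j<Suc k. F (Suc k) j) * (\<Prod>j<k - 1. F (k - 1) j) * (\<Prod>j<k. F k j)"
    using assms by (simp add: mult.assoc)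
  also have "(\<Prod>j<k. F k j) = (\<Prod>j\<in>{..<k} - {i}. inverse ((x - gt_coord g (k, j)) * (x - gt_coord g (k, j) + 1)))"
    by (rule prod.mono_neutral_cong_right) (auto simp: F_def)
  also have "(\<Prod>j<Suc k. F (Suc k) j) = (\<Prod>j<Suc k. x - gt_coord g (Suc k, j))"
    by (intro prod.cong refl) (simp add: F_def)
  also have "(\<Prod>j<k - 1. F (k - 1) j) = (\<Prod>j<k - 1. x + 1 - gt_coord g (k - 1, j))"
    using assms by (intro prod.cong refl) (auto simp: F_def)
  finally show ?thesis unfolding gt_weight_at_def row_prod_def by simp
qed

lemma gt_interlacing_rows:
  assumes g: "g \<in> gt_patterns n \<mu>" and "0 < k" "k < n"
  shows "interlacing_rows k (\<lambda>j. gt_coord g (Suc k, j)) (\<lambda>j. gt_coord g (k - 1, j)) (\<lambda>j. gt_coord g (k, j))"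
proof
  have up: "g (k, i) \<le> g (Suc k, i)" "g (Suc k, Suc i) \<le> g (k, i)"
    and dn: "g (k - 1, i) \<le> g (k, i)" "g (k, Suc i) \<le> g (k - 1, i)" for i
  proof -
    have *: "g (k', i) \<le> g (Suc k', i)" "g (Suc k', Suc i) \<le> g (k', i)" if "k' < n" for k' i
      using g that by (auto simp: gt_patterns_def)
    show "g (k, i) \<le> g (Suc k, i)" "g (Suc k, Suc i) \<le> g (k, i)" using *[of k i] assms(3) by auto
    show "g (k - 1, i) \<le> g (k, i)" "g (k, Suc i) \<le> g (k - 1, i)" using *[of "k - 1" i] assms(2,3) by auto
  qed
  show "gt_coord g (k, i) \<le> gt_coord g (Suc k, i)" for i using up(1)[of i] by (simp add: gt_coord_def)
  show "gt_coord g (Suc k, Suc i) \<le> gt_coord g (k, i) - 1" for i using up(2)[of i] by (simp add: gt_coord_def)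
  show "gt_coord g (k - 1, i) \<le> gt_coord g (k, i)" for i using dn(1)[of i] by (simp add: gt_coord_def)
  show "gt_coord g (k, Suc i) + 1 \<le> gt_coord g (k - 1, i)" for i using dn(2)[of i] by (simp add: gt_coord_def)
qed (use assms in auto)

text \<open>An entry can be blocked from above only by its neighbour in the longer row or by the
  preceding entry of the shorter row, and both barriers are zeros of \<open>row_prod\<close>. The
  commutator sums may thus run over all moves, admissible or not.\<close>

lemma gt_weight_eq_0:
  assumes g: "g \<in> gt_patterns n \<mu>" and p: "p \<in> gt_moves n" and out: "g(p := Suc (g p)) \<notin> gt_patterns n \<mu>"
  shows "gt_weight n p g = 0"
proof -
  obtain k i where ki: "p = (k, i)" "k < n" "i < k" using p by (auto simp: gt_moves_def)
  have "g (k, i) = g (Suc k, i) \<or> (\<exists>j. i = Suc j \<and> g (k, i) = g (k - 1, j))"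
  proof (rule ccontr)
    assume neg: "\<not> ?thesis"
    have "g(p := Suc (g p)) \<in> gt_patterns n \<mu>"
      unfolding gt_patterns_def mem_Collect_eq
    proof (intro conjI allI impI)
      fix k' j assume k': "k' < n"
      have G: "g (k', j) \<le> g (Suc k', j)" "g (Suc k', Suc j) \<le> g (k', j)"
        using g k' by (auto simp: gt_patterns_def)
      show "(g(p := Suc (g p))) (k', j) \<le> (g(p := Suc (g p))) (Suc k', j)"
        using G neg ki by (auto simp: le_eq_less_or_eq)
      show "(g(p := Suc (g p))) (Suc k', Suc j) \<le> (g(p := Suc (g p))) (k', j)"
        using G neg ki by (auto simp: le_eq_less_or_eq)
    qed (use g ki in \<open>auto simp: gt_patterns_def\<close>)
    with out show False ..
  qed
  then have "row_prod k (\<lambda>j. gt_coord g (Suc k, j)) (\<lambda>j. gt_coord g (k - 1, j)) (\<lambda>j. gt_coord g (k, j)) i (gt_coord g (k, i)) = 0"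
  proof (elim disjE exE conjE)
    assume "g (k, i) = g (Suc k, i)"
    then have "(\<Prod>j<Suc k. gt_coord g (k, i) - gt_coord g (Suc k, j)) = 0"
      using ki by (intro prod_zero) (auto intro!: bexI[of _ i] simp: gt_coord_def)
    then show ?thesis by (simp add: row_prod_def)
  next
    fix j assume "i = Suc j" "g (k, i) = g (k - 1, j)"
    then have "(\<Prod>j<k - 1. gt_coord g (k, i) + 1 - gt_coord g (k - 1, j)) = 0"
      using ki by (intro prod_zero) (auto intro!: bexI[of _ j] simp: gt_coord_def)
    then show ?thesis by (simp add: row_prod_def)
  qed
  then show ?thesis unfolding gt_weight_def using ki by (simp add: gt_weight_at_eq_row_prod)
qed

text \<open>The counterpart for arriving moves: both lower barriers of an entry are zeros one unit
  below its coordinate.\<close>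

lemma gt_weight_below_eq_0:
  assumes g: "g \<in> gt_patterns n \<mu>" and p: "p \<in> gt_moves n"
    and out: "\<not> (0 < g p \<and> g(p := g p - 1) \<in> gt_patterns n \<mu>)"
  shows "gt_weight_at n p g (gt_coord g p - 1) = 0"
proof -
  obtain k i where ki: "p = (k, i)" "k < n" "i < k" using p by (auto simp: gt_moves_def)
  have "g (k, i) = g (Suc k, Suc i) \<or> i < k - 1 \<and> g (k, i) = g (k - 1, i)"
  proof (rule ccontr)
    assume neg: "\<not> ?thesis"
    have G: "g (k', j) \<le> g (Suc k', j)" "g (Suc k', Suc j) \<le> g (k', j)" if "k' < n" for k' j
      using g that by (auto simp: gt_patterns_def)
    have gt1: "g (Suc k, Suc i) < g (k, i)" using neg G(2)[OF \<open>k < n\<close>, of i] by auto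
    have gt2: "g (k - 1, i) < g (k, i)"
    proof (cases "i < k - 1")
      case True
      have "k - 1 < n" "Suc (k - 1) = k" using ki by auto
      then have "g (k - 1, i) \<le> g (k, i)" using G(1)[of "k - 1" i] by simp
      then show ?thesis using neg True by auto
    next
      case False
      \<comment> \<open>The last entry of row \<open>k\<close> has no lower neighbour in the shorter
        row, only the padding value.\<close>
      then have "g (k - 1, i) = 0" using gt_patterns_zero[OF g] by simp
      then show ?thesis using gt1 by simp
    qed
    have "g(p := g p - 1) \<in> gt_patterns n \<mu>"
      unfolding gt_patterns_def mem_Collect_eq
    proof (intro conjI allI impI)
      fix k' j assume k': "k' < n"
      show "(g(p := g p - 1)) (k', j) \<le> (g(p := g p - 1)) (Suc k', j)"
        using G[OF k', of j] gt2 ki by (auto simp: le_eq_less_or_eq)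
      show "(g(p := g p - 1)) (Suc k', Suc j) \<le> (g(p := g p - 1)) (k', j)"
        using G[OF k', of j] gt1 ki by (auto simp: le_eq_less_or_eq)
    qed (use g ki in \<open>auto simp: gt_patterns_def\<close>)
    with out gt1 ki show False by simp
  qed
  then have "row_prod k (\<lambda>j. gt_coord g (Suc k, j)) (\<lambda>j. gt_coord g (k - 1, j)) (\<lambda>j. gt_coord g (k, j)) i (gt_coord g (k, i) - 1) = 0"
  proof (elim disjE conjE)
    assume "g (k, i) = g (Suc k, Suc i)"
    then have "(\<Prod>j<Suc k. gt_coord g (k, i) - 1 - gt_coord g (Suc k, j)) = 0"
      using ki by (intro prod_zero) (auto intro!: bexI[of _ "Suc i"] simp: gt_coord_def)
    then show ?thesis by (simp add: row_prod_def)
  next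
    assume "i < k - 1" "g (k, i) = g (k - 1, i)"
    then have "(\<Prod>j<k - 1. gt_coord g (k, i) - 1 + 1 - gt_coord g (k - 1, j)) = 0"
      using ki by (intro prod_zero) (auto intro!: bexI[of _ i] simp: gt_coord_def)
    then show ?thesis by (simp add: row_prod_def)
  qed
  then show ?thesis using ki by (simp add: gt_weight_at_eq_row_prod)
qed

text \<open>The second difference of \<open>k (N - k)\<close> is \<open>-2\<close>, so summation by
  parts leaves minus twice the plain sum and boundary terms. For \<open>N = m + 1\<close> and
  \<open>f 0 = 0\<close> only \<open>m * f (Suc m)\<close> survives of these.\<close>

lemma weighted_second_difference:
  fixes f :: "nat \<Rightarrow> real"
  shows "(\<Sum>k<Suc m. real k * (N - real k) * (f (Suc k) + f (k - 1) - 2 * f k))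
    = real m * (N - real m) * f (Suc m) - (real m + 1) * (N - (real m + 1)) * f m
      - 2 * (\<Sum>k<Suc m. f k) + (N + 1) * f 0"
  by (induction m) (simp_all add: algebra_simps)

text \<open>By the residue sum, row \<open>k\<close> contributes \<open>k (n - k)\<close> times the
  second difference of the row sums; the shifts hidden in the coordinates cancel.\<close>

lemma sum_gt_weight_difference:
  assumes g: "g \<in> gt_patterns n \<mu>"
  shows "(\<Sum>p\<in>gt_moves n. gt_weight n p g - gt_weight_at n p g (gt_coord g p - 1))
    = real ((n - 1) * (\<Sum>i<n. \<mu> i)) - 2 * real (gt_degree n g)"
proof (cases n)
  case 0
  then show ?thesis by (simp add: gt_moves_def gt_degree_def)
next
  case (Suc m)
  define f where "f k = (\<Sum>i<k. real (g (k, i)))" for k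
  have coords: "(\<Sum>i<k. gt_coord g (k, i)) = f k - real k * (real k - 1) / 2" for k
  proof -
    have "(\<Sum>i<k. real i) = real k * (real k - 1) / 2" by (induction k) (simp_all add: field_simps)
    then show ?thesis by (simp add: gt_coord_def f_def sum_subtractf)
  qed
  have row: "(\<Sum>i<k. gt_weight n (k, i) g - gt_weight_at n (k, i) g (gt_coord g (k, i) - 1))
     = real k * (real n - real k) * (f (Suc k) + f (k - 1) - 2 * f k)" if kn: "k < n" for k
  proof (cases "k = 0")
    case False
    then interpret interlacing_rows k "\<lambda>j. gt_coord g (Suc k, j)" "\<lambda>j. gt_coord g (k - 1, j)" "\<lambda>j. gt_coord g (k, j)"
      using gt_interlacing_rows[OF g] kn by simp
    have "(\<Sum>i<k. gt_weight n (k, i) g - gt_weight_at n (k, i) g (gt_coord g (k, i) - 1))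
      = - (real k * (real n - real k)) * ((\<Sum>i<k. 2 * gt_coord g (k, i) - 1)
         - (\<Sum>i<Suc k. gt_coord g (Suc k, i)) - (\<Sum>i<k - 1. gt_coord g (k - 1, i) - 1))"
      unfolding sum_row_prod[symmetric] sum_distrib_left
      by (intro sum.cong refl) (simp add: gt_weight_def gt_weight_at_eq_row_prod kn algebra_simps)
    also have "(\<Sum>i<k. 2 * gt_coord g (k, i) - 1) = 2 * (f k - real k * (real k - 1) / 2) - real k"
      unfolding coords[symmetric] by (simp add: sum_subtractf flip: sum_distrib_left)
    also have "(\<Sum>i<k - 1. gt_coord g (k - 1, i) - 1) = f (k - 1) - (real k - 1) * (real k - 2) / 2 - (real k - 1)"
      using coords[of "k - 1"] False by (simp add: sum_subtractf of_nat_diff)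
    finally show ?thesis unfolding coords by (simp add: field_simps)
  qed simp
  have "(\<Sum>p\<in>gt_moves n. gt_weight n p g - gt_weight_at n p g (gt_coord g p - 1))
     = (\<Sum>k<n. \<Sum>i<k. gt_weight n (k, i) g - gt_weight_at n (k, i) g (gt_coord g (k, i) - 1))"
    unfolding gt_moves_def by (subst sum.Sigma) auto
  also have "\<dots> = (\<Sum>k<n. real k * (real n - real k) * (f (Suc k) + f (k - 1) - 2 * f k))"
    by (intro sum.cong refl) (simp add: row)
  also have "\<dots> = real m * f n - 2 * (\<Sum>k<n. f k)"
    unfolding Suc weighted_second_difference by (simp add: f_def)
  also have "f n = real (\<Sum>i<n. \<mu> i)" using g by (simp add: f_def gt_patterns_def)
  also have "(\<Sum>k<n. f k) = real (gt_degree n g)" by (simp add: f_def gt_degree_def)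
  finally show ?thesis using Suc by simp
qed

lemma graded_diamonds_gt_patterns:
  "graded_diamonds (gt_patterns n \<mu>) (gt_moves n) (gt_step n \<mu>) (gt_weight n) (gt_degree n) ((n - 1) * (\<Sum>i<n. \<mu> i))"
proof
  show "finite (gt_patterns n \<mu>)" by (rule finite_gt_patterns)
  show "finite (gt_moves n)" by (simp add: gt_moves_def)
  show "g \<in> gt_patterns n \<mu> \<and> h \<in> gt_patterns n \<mu> \<and> gt_degree n h = Suc (gt_degree n g)"
    if "gt_step n \<mu> p g h" for p g h
  proof -
    from that have p: "p \<in> gt_moves n" and h: "h = g(p := Suc (g p))" by (auto simp: gt_step_def)
    have deg: "gt_degree n g = sum g (gt_moves n)" for g
      unfolding gt_degree_def gt_moves_def by (subst sum.Sigma) auto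
    have "sum h (gt_moves n) = Suc (sum g (gt_moves n))"
      using p by (simp add: h gt_moves_def sum.remove[of "Sigma _ _" p])
    then show ?thesis using that unfolding deg by (auto simp: gt_step_def)
  qed
  show "h = h'" if "gt_step n \<mu> p g h" "gt_step n \<mu> p g h'" for p g h h'
    using that by (simp add: gt_step_def)
  show "g = g'" if "gt_step n \<mu> p g h" "gt_step n \<mu> p g' h" for p g h g'
    using that by (auto simp: gt_step_def fun_eq_iff split: if_splits)
  show "\<exists>l. gt_step n \<mu> q l g \<and> gt_step n \<mu> p l h"
    if "gt_step n \<mu> p g u" "gt_step n \<mu> q h u" "p \<noteq> q" for p g u q h
  proof -
    have eq: "g(p := Suc (g p)) = h(q := Suc (h q))" using that by (simp add: gt_step_def)
    have ptw: "g r = (if r = q then Suc (h q) else h r)" if "r \<noteq> p" for r using fun_cong[OF eq, of r] that by simp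
    have ptw': "h p = Suc (g p)" using fun_cong[OF eq, of p] \<open>p \<noteq> q\<close> by simp
    have "g r = ((inf g h)(q := Suc (inf g h q))) r" "h r = ((inf g h)(p := Suc (inf g h p))) r" for r
      using ptw[of r] ptw[of q] ptw' \<open>p \<noteq> q\<close> by (cases "r = p"; cases "r = q"; simp add: inf_nat_def)+
    then have "g = (inf g h)(q := Suc (inf g h q))" "h = (inf g h)(p := Suc (inf g h p))" by blast+
    then show ?thesis using that gt_patterns_inf[of g n \<mu> h] unfolding gt_step_def by blast
  qed
  show "\<exists>u. gt_step n \<mu> p g u \<and> gt_step n \<mu> q h u"
    if "gt_step n \<mu> q l g" "gt_step n \<mu> p l h" "p \<noteq> q" for q l g p h
  proof -
    have gh: "g = l(q := Suc (l q))" "h = l(p := Suc (l p))" using that by (auto simp: gt_step_def)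
    have "sup g h = g(p := Suc (g p))" "sup g h = h(q := Suc (h q))"
      using \<open>p \<noteq> q\<close> by (auto simp: gh fun_eq_iff sup_nat_def)
    then show ?thesis using that gt_patterns_sup[of g n \<mu> h] unfolding gt_step_def by metis
  qed
  show "gt_weight n p g * gt_weight n q h = gt_weight n p l * gt_weight n q l"
    if "gt_step n \<mu> q l g" "gt_step n \<mu> p l h" "p \<noteq> q" for q l g p h
    using that gt_weight_diamond[of p q n l] by (simp add: gt_step_def)
  show "0 \<le> gt_weight n p g" if "gt_step n \<mu> p g h" for p g h
  proof -
    have "p \<in> gt_moves n" using that by (simp add: gt_step_def)
    then obtain k i where ki: "p = (k, i)" "k < n" "i < k" by (auto simp: gt_moves_def)
    interpret interlacing_rows k "\<lambda>j. gt_coord g (Suc k, j)" "\<lambda>j. gt_coord g (k - 1, j)" "\<lambda>j. gt_coord g (k, j)"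
      using gt_interlacing_rows[of g n \<mu> k] ki that by (simp add: gt_step_def)
    show ?thesis using row_prod_nonpos[of i] ki
      by (simp add: gt_weight_def gt_weight_at_eq_row_prod mult_nonneg_nonpos)
  qed
  show "(\<Sum>p\<in>gt_moves n. \<Sum>u\<in>gt_patterns n \<mu>. if gt_step n \<mu> p g u then gt_weight n p g else 0)
     - (\<Sum>p\<in>gt_moves n. \<Sum>u\<in>gt_patterns n \<mu>. if gt_step n \<mu> p u g then gt_weight n p u else 0)
     = real ((n - 1) * (\<Sum>i<n. \<mu> i)) - 2 * real (gt_degree n g)" if g: "g \<in> gt_patterns n \<mu>" for g
  proof -
    have up: "(\<Sum>u\<in>gt_patterns n \<mu>. if gt_step n \<mu> p g u then gt_weight n p g else 0) = gt_weight n p g"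
      if p: "p \<in> gt_moves n" for p
    proof -
      have "(\<Sum>u\<in>gt_patterns n \<mu>. if gt_step n \<mu> p g u then gt_weight n p g else 0)
        = (\<Sum>u\<in>gt_patterns n \<mu>. if u = g(p := Suc (g p)) then gt_weight n p g else 0)"
        using g p by (intro sum.cong refl) (auto simp: gt_step_def)
      also have "\<dots> = gt_weight n p g"
        using gt_weight_eq_0[OF g p] by (simp add: finite_gt_patterns)
      finally show ?thesis .
    qed
    have down: "(\<Sum>u\<in>gt_patterns n \<mu>. if gt_step n \<mu> p u g then gt_weight n p u else 0)
       = gt_weight_at n p g (gt_coord g p - 1)" if p: "p \<in> gt_moves n" for p
    proof -
      define g' where "g' = g(p := g p - 1)"
      have step: "gt_step n \<mu> p u g \<longleftrightarrow> u = g' \<and> 0 < g p" if "u \<in> gt_patterns n \<mu>" for u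
      proof
        assume "gt_step n \<mu> p u g"
        then have "g = u(p := Suc (u p))" by (simp add: gt_step_def)
        then show "u = g' \<and> 0 < g p" by (simp add: g'_def)
      next
        assume u: "u = g' \<and> 0 < g p"
        then have "g = u(p := Suc (u p))" by (simp add: g'_def)
        then show "gt_step n \<mu> p u g" using that g p by (simp add: gt_step_def)
      qed
      have w: "gt_weight n p g' = gt_weight_at n p g (gt_coord g p - 1)" if "0 < g p"
      proof -
        have "gt_coord g' p = gt_coord g p - 1" using that by (simp add: g'_def gt_coord_def of_nat_diff)
        moreover have "gt_weight_at n p g' x = gt_weight_at n p g x" for x
          unfolding gt_weight_at_def
          by (intro arg_cong2[where f = "(*)"] refl prod.cong) (auto simp: g'_def gt_coord_def)
        ultimately show ?thesis by (simp add: gt_weight_def)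
      qed
      have "(\<Sum>u\<in>gt_patterns n \<mu>. if gt_step n \<mu> p u g then gt_weight n p u else 0)
        = (\<Sum>u\<in>gt_patterns n \<mu>. if u = g' then (if 0 < g p then gt_weight n p g' else 0) else 0)"
        by (intro sum.cong refl) (auto simp: step)
      also have "\<dots> = gt_weight_at n p g (gt_coord g p - 1)"
        using gt_weight_below_eq_0[OF g p] w by (auto simp: finite_gt_patterns g'_def)
      finally show ?thesis .
    qed
    show ?thesis
      using sum_gt_weight_difference[OF g] by (simp add: up down sum_subtractf)
  qed
qed

lemmas card_gt_level_mono = graded_diamonds.card_level_mono[OF graded_diamonds_gt_patterns]

section \<open>The branching rule for Schur polynomials\<close>

definition interlacing :: "nat \<Rightarrow> (nat \<Rightarrow> nat) \<Rightarrow> (nat \<Rightarrow> nat) set" where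
  "interlacing n \<mu> = {\<nu>. (\<forall>i<n. \<mu> (Suc i) \<le> \<nu> i \<and> \<nu> i \<le> \<mu> i) \<and> (\<forall>i\<ge>n. \<nu> i = 0)}"

lemma interlacing_antimono:
  assumes "\<nu> \<in> interlacing n \<mu>"
  shows "antimono \<nu>"
  unfolding antimono_iff_le_Suc
proof
  fix i
  show "\<nu> (Suc i) \<le> \<nu> i"
  proof (cases "Suc i < n")
    case True
    then have "\<nu> (Suc i) \<le> \<mu> (Suc i)" "\<mu> (Suc i) \<le> \<nu> i" using assms by (auto simp: interlacing_def)
    then show ?thesis by (rule le_trans)
  next
    case False
    then show ?thesis using assms by (simp add: interlacing_def)
  qed
qed

lemma interlacing_le: "\<nu> \<in> interlacing n \<mu> \<Longrightarrow> \<nu> i \<le> \<mu> i"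
  by (cases "i < n") (auto simp: interlacing_def)

lemma finite_interlacing: "finite (interlacing n \<mu>)"
proof (rule finite_subset)
  show "interlacing n \<mu> \<subseteq> {f. \<forall>i. (i \<in> {..<n} \<longrightarrow> f i \<in> {..Max (\<mu> ` {..<n})}) \<and> (i \<notin> {..<n} \<longrightarrow> f i = 0)}"
  proof clarify
    fix \<nu> i assume \<nu>: "\<nu> \<in> interlacing n \<mu>"
    have "\<nu> i \<le> Max (\<mu> ` {..<n})" if "i < n"
      by (rule order_trans[OF interlacing_le[OF \<nu>]]) (use that in simp)
    then show "(i \<in> {..<n} \<longrightarrow> \<nu> i \<in> {..Max (\<mu> ` {..<n})}) \<and> (i \<notin> {..<n} \<longrightarrow> \<nu> i = 0)"
      using \<nu> by (auto simp: interlacing_def)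
  qed
qed (rule finite_set_of_finite_funs, auto)

lemma cells_Sigma: "(\<And>i. i \<ge> n \<Longrightarrow> \<mu> i = 0) \<Longrightarrow> cells \<mu> = (SIGMA i:{..<n}. {..<\<mu> i})"
  unfolding cells_def by (auto, metis leI not_less0)

lemma finite_cells: "(\<And>i. i \<ge> n \<Longrightarrow> \<mu> i = 0) \<Longrightarrow> finite (cells \<mu>)"
  by (subst cells_Sigma) auto

lemma card_cells: "(\<And>i. i \<ge> n \<Longrightarrow> \<mu> i = 0) \<Longrightarrow> card (cells \<mu>) = (\<Sum>i<n. \<mu> i)"
  by (subst cells_Sigma) auto

lemma ssytD:
  assumes "T \<in> ssyt n \<mu>"
  shows "j < \<mu> i \<Longrightarrow> T (i, j) < n" "j < j' \<Longrightarrow> j' < \<mu> i \<Longrightarrow> T (i, j) \<le> T (i, j')"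
    "i < i' \<Longrightarrow> j < \<mu> i \<Longrightarrow> j < \<mu> i' \<Longrightarrow> T (i, j) < T (i', j)" "\<not> j < \<mu> i \<Longrightarrow> T (i, j) = undefined"
  using assms by (auto simp: ssyt_def cells_def PiE_def extensional_def Pi_def)

lemma ssytI:
  assumes "\<And>i j. j < \<mu> i \<Longrightarrow> T (i, j) < n" "\<And>i j j'. j < j' \<Longrightarrow> j' < \<mu> i \<Longrightarrow> T (i, j) \<le> T (i, j')"
    "\<And>i i' j. i < i' \<Longrightarrow> j < \<mu> i \<Longrightarrow> j < \<mu> i' \<Longrightarrow> T (i, j) < T (i', j)" "\<And>i j. \<not> j < \<mu> i \<Longrightarrow> T (i, j) = undefined"
  shows "T \<in> ssyt n \<mu>"
  using assms by (auto simp: ssyt_def cells_def PiE_def extensional_def Pi_def)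

lemma ssyt_ge_row:
  assumes T: "T \<in> ssyt n \<mu>" and "antimono \<mu>" "j < \<mu> i"
  shows "i \<le> T (i, j)"
  using assms(3)
proof (induction i)
  case (Suc i)
  have "\<mu> (Suc i) \<le> \<mu> i" using \<open>antimono \<mu>\<close> by (simp add: antimono_def)
  then have "i \<le> T (i, j)" "T (i, j) < T (Suc i, j)" using Suc ssytD(3)[OF T] by auto
  then show ?case by simp
qed simp

definition inner_shape :: "nat \<Rightarrow> (nat \<Rightarrow> nat) \<Rightarrow> (nat \<times> nat \<Rightarrow> nat) \<Rightarrow> nat \<Rightarrow> nat" where
  "inner_shape n \<mu> T i = card {j. j < \<mu> i \<and> T (i, j) < n}"

definition extend_tableau :: "nat \<Rightarrow> (nat \<Rightarrow> nat) \<Rightarrow> (nat \<Rightarrow> nat) \<Rightarrow> (nat \<times> nat \<Rightarrow> nat) \<Rightarrow> nat \<times> nat \<Rightarrow> nat" where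
  "extend_tableau n \<mu> \<nu> S c = (if c \<in> cells \<nu> then S c else if c \<in> cells \<mu> then n else undefined)"

lemma down_closed_eq_lessThan:
  fixes S :: "nat set"
  assumes "finite S" "\<And>i j. j \<in> S \<Longrightarrow> i < j \<Longrightarrow> i \<in> S"
  shows "S = {..<card S}"
proof (cases "S = {}")
  case False
  then have "Max S \<in> S" using assms(1) by (rule Max_in[rotated])
  then have "S = {..Max S}"
    using assms Max_ge[of S] by (auto simp: le_eq_less_or_eq)
  then show ?thesis by (metis card_atMost lessThan_Suc_atMost)
qed simp

lemma less_inner_shape_iff:
  assumes T: "T \<in> ssyt (Suc n) \<mu>"
  shows "j < inner_shape n \<mu> T i \<longleftrightarrow> j < \<mu> i \<and> T (i, j) < n"
proof -
  have "{j. j < \<mu> i \<and> T (i, j) < n} = {..<inner_shape n \<mu> T i}"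
    unfolding inner_shape_def
    by (rule down_closed_eq_lessThan) (use ssytD(2)[OF T] in \<open>auto intro: le_less_trans\<close>)
  then show ?thesis by auto
qed

lemma inner_shape_interlacing:
  assumes T: "T \<in> ssyt (Suc n) \<mu>" and mu: "antimono \<mu>"
  shows "inner_shape n \<mu> T \<in> interlacing n \<mu>"
  unfolding interlacing_def
proof (intro CollectI conjI allI impI)
  fix i
  show "\<mu> (Suc i) \<le> inner_shape n \<mu> T i"
  proof (rule ccontr)
    assume "\<not> ?thesis"
    then have j: "inner_shape n \<mu> T i < \<mu> (Suc i)" by simp
    moreover have "\<mu> (Suc i) \<le> \<mu> i" using mu by (simp add: antimono_def)
    ultimately have "T (i, inner_shape n \<mu> T i) < T (Suc i, inner_shape n \<mu> T i)"
       "T (Suc i, inner_shape n \<mu> T i) < Suc n" "inner_shape n \<mu> T i < \<mu> i"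
      using ssytD[OF T] by auto
    then show False using less_inner_shape_iff[OF T, of "inner_shape n \<mu> T i" i] by simp
  qed
  show "inner_shape n \<mu> T i \<le> \<mu> i"
    using less_inner_shape_iff[OF T, of "\<mu> i" i] by simp
next
  fix i assume "n \<le> i"
  then have "\<not> 0 < inner_shape n \<mu> T i"
    using less_inner_shape_iff[OF T, of 0 i] ssyt_ge_row[OF T mu, of 0 i] by auto
  then show "inner_shape n \<mu> T i = 0" by simp
qed

lemma extend_tableau_ssyt:
  assumes \<nu>: "\<nu> \<in> interlacing n \<mu>" and S: "S \<in> ssyt n \<nu>" and mu: "antimono \<mu>"
    and supp: "\<And>i. i > n \<Longrightarrow> \<mu> i = 0"
  shows "extend_tableau n \<mu> \<nu> S \<in> ssyt (Suc n) \<mu>"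
proof (rule ssytI)
  note le = interlacing_le[OF \<nu>]
  show "extend_tableau n \<mu> \<nu> S (i, j) < Suc n" if "j < \<mu> i" for i j
    using that ssytD(1)[OF S, of j i] by (auto simp: extend_tableau_def cells_def)
  show "extend_tableau n \<mu> \<nu> S (i, j) \<le> extend_tableau n \<mu> \<nu> S (i, j')" if "j < j'" "j' < \<mu> i" for i j j'
    using that ssytD(1)[OF S, of j i] ssytD(2)[OF S, of j j' i] by (auto simp: extend_tableau_def cells_def)
  show "extend_tableau n \<mu> \<nu> S (i, j) = undefined" if "\<not> j < \<mu> i" for i j
    using that le[of i] by (auto simp: extend_tableau_def cells_def)
  show "extend_tableau n \<mu> \<nu> S (i, j) < extend_tableau n \<mu> \<nu> S (i', j)"
    if "i < i'" "j < \<mu> i" "j < \<mu> i'" for i i' j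
  proof -
    \<comment> \<open>A cell of \<open>\<mu>\<close> with another one below it already lies in
      \<open>\<nu>\<close> by interlacing, so two new entries \<open>n\<close> never share a
      column.\<close>
    have "i < n" using supp[of i'] that by (metis gr0I leI le_less_trans not_less_zero)
    moreover have "\<mu> i' \<le> \<mu> (Suc i)" using mu that by (simp add: antimono_def)
    ultimately have j: "j < \<nu> i" using \<nu> that unfolding interlacing_def by force
    show ?thesis
      using that j ssytD(1)[OF S, of j i] ssytD(3)[OF S, of i i' j] by (auto simp: extend_tableau_def cells_def)
  qed
qed

text \<open>The entries equal to \<open>n\<close> form a horizontal strip; deleting them is the branching rule.\<close>

lemma schur_Suc:
  assumes mu: "antimono \<mu>" and supp: "\<And>i. i > n \<Longrightarrow> \<mu> i = 0"
  shows "schur (Suc n) \<mu> x = (\<Sum>\<nu>\<in>interlacing n \<mu>. schur n \<nu> x * x n ^ ((\<Sum>i<Suc n. \<mu> i) - (\<Sum>i<n. \<nu> i)))"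
proof -
  have supp_\<nu>: "\<nu> i = 0" if "\<nu> \<in> interlacing n \<mu>" "i \<ge> n" for \<nu> i
    using that by (simp add: interlacing_def)
  have fin_ssyt: "finite (ssyt n \<nu>)" if "\<nu> \<in> interlacing n \<mu>" for \<nu>
  proof (rule finite_subset)
    show "ssyt n \<nu> \<subseteq> cells \<nu> \<rightarrow>\<^sub>E {..<n}" by (auto simp: ssyt_def)
    show "finite (cells \<nu> \<rightarrow>\<^sub>E {..<n})" using finite_cells[of n \<nu>] supp_\<nu>[OF that] by (intro finite_PiE) auto
  qed
  have "schur (Suc n) \<mu> x = (\<Sum>T\<in>ssyt (Suc n) \<mu>. \<Prod>c\<in>cells \<mu>. x (T c))" by (simp add: schur_def)
  also have "\<dots> = (\<Sum>(\<nu>, S)\<in>(SIGMA \<nu>:interlacing n \<mu>. ssyt n \<nu>).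
     (\<Prod>c\<in>cells \<nu>. x (S c)) * x n ^ ((\<Sum>i<Suc n. \<mu> i) - (\<Sum>i<n. \<nu> i)))"
  proof (rule sum.reindex_bij_witness[where i = "\<lambda>(\<nu>, S). extend_tableau n \<mu> \<nu> S"
        and j = "\<lambda>T. (inner_shape n \<mu> T, restrict T (cells (inner_shape n \<mu> T)))"])
    fix T assume T: "T \<in> ssyt (Suc n) \<mu>"
    define \<nu> where "\<nu> = inner_shape n \<mu> T"
    have \<nu>: "\<nu> \<in> interlacing n \<mu>" unfolding \<nu>_def by (rule inner_shape_interlacing[OF T mu])
    have iff: "j < \<nu> i \<longleftrightarrow> j < \<mu> i \<and> T (i, j) < n" for i j
      unfolding \<nu>_def by (rule less_inner_shape_iff[OF T])
    have big: "T c = n" if "c \<in> cells \<mu>" "c \<notin> cells \<nu>" for c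
      using that ssytD(1)[OF T, of "snd c" "fst c"] by (cases c) (auto simp: cells_def iff)
    have outside: "T c = undefined" if "c \<notin> cells \<mu>" for c
      using that ssytD(4)[OF T, of "snd c" "fst c"] by (cases c) (auto simp: cells_def)
    show "(case (inner_shape n \<mu> T, restrict T (cells (inner_shape n \<mu> T))) of (\<nu>, S) \<Rightarrow> extend_tableau n \<mu> \<nu> S) = T"
      using big outside by (auto simp: extend_tableau_def fun_eq_iff \<nu>_def)
    show "(inner_shape n \<mu> T, restrict T (cells (inner_shape n \<mu> T))) \<in> (SIGMA \<nu>:interlacing n \<mu>. ssyt n \<nu>)"
    proof -
      have "restrict T (cells \<nu>) \<in> ssyt n \<nu>"
      proof (rule ssytI)
        show "restrict T (cells \<nu>) (i, j) \<le> restrict T (cells \<nu>) (i, j')" if "j < j'" "j' < \<nu> i" for i j j'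
        proof -
          have "j < \<nu> i" using that by simp
          then show ?thesis using that ssytD(2)[OF T, of j j' i] by (simp add: cells_def iff)
        qed
      qed (use ssytD[OF T] in \<open>auto simp: cells_def iff\<close>)
      then show ?thesis using \<nu> by (simp add: \<nu>_def)
    qed
    have sub: "cells \<nu> \<subseteq> cells \<mu>" by (auto simp: cells_def iff)
    have fin: "finite (cells \<mu>)" using supp by (intro finite_cells[of "Suc n"]) auto
    have "(\<Prod>c\<in>cells \<mu>. x (T c)) = (\<Prod>c\<in>cells \<mu> - cells \<nu>. x (T c)) * (\<Prod>c\<in>cells \<nu>. x (T c))"
      by (rule prod.subset_diff[OF sub fin])
    also have "(\<Prod>c\<in>cells \<mu> - cells \<nu>. x (T c)) = x n ^ (card (cells \<mu>) - card (cells \<nu>))"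
      using sub fin by (simp add: big card_Diff_subset finite_subset)
    also have "card (cells \<mu>) = (\<Sum>i<Suc n. \<mu> i)" using supp by (intro card_cells) auto
    also have "card (cells \<nu>) = (\<Sum>i<n. \<nu> i)" using supp_\<nu>[OF \<nu>] by (intro card_cells) auto
    finally show "(case (inner_shape n \<mu> T, restrict T (cells (inner_shape n \<mu> T))) of
        (\<nu>, S) \<Rightarrow> (\<Prod>c\<in>cells \<nu>. x (S c)) * x n ^ ((\<Sum>i<Suc n. \<mu> i) - (\<Sum>i<n. \<nu> i))) = (\<Prod>c\<in>cells \<mu>. x (T c))"
      by (simp add: \<nu>_def mult.commute)
  next
    fix p assume "p \<in> (SIGMA \<nu>:interlacing n \<mu>. ssyt n \<nu>)"
    then obtain \<nu> S where p: "p = (\<nu>, S)" and \<nu>: "\<nu> \<in> interlacing n \<mu>" and S: "S \<in> ssyt n \<nu>" by auto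
    define T where "T = extend_tableau n \<mu> \<nu> S"
    have T: "T \<in> ssyt (Suc n) \<mu>" unfolding T_def by (rule extend_tableau_ssyt[OF \<nu> S mu supp])
    then show "(case p of (\<nu>, S) \<Rightarrow> extend_tableau n \<mu> \<nu> S) \<in> ssyt (Suc n) \<mu>" by (simp add: p T_def)
    have "{j. j < \<mu> i \<and> T (i, j) < n} = {..<\<nu> i}" for i
      using ssytD(1)[OF S] interlacing_le[OF \<nu>, of i] by (auto simp: T_def extend_tableau_def cells_def)
    then have sh: "inner_shape n \<mu> T = \<nu>" by (simp add: inner_shape_def fun_eq_iff)
    have "restrict T (cells \<nu>) = S"
      using ssytD(4)[OF S] by (auto simp: fun_eq_iff T_def extend_tableau_def restrict_def cells_def)
    then show "(inner_shape n \<mu> (case p of (\<nu>, S) \<Rightarrow> extend_tableau n \<mu> \<nu> S),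
        restrict (case p of (\<nu>, S) \<Rightarrow> extend_tableau n \<mu> \<nu> S)
         (cells (inner_shape n \<mu> (case p of (\<nu>, S) \<Rightarrow> extend_tableau n \<mu> \<nu> S)))) = p"
      using sh by (simp add: p T_def)
  qed
  also have "\<dots> = (\<Sum>\<nu>\<in>interlacing n \<mu>. \<Sum>S\<in>ssyt n \<nu>. (\<Prod>c\<in>cells \<nu>. x (S c)) * x n ^ ((\<Sum>i<Suc n. \<mu> i) - (\<Sum>i<n. \<nu> i)))"
    by (rule sum.Sigma[symmetric]) (use finite_interlacing fin_ssyt in auto)
  finally show ?thesis by (simp add: schur_def sum_distrib_right)
qed

lemma schur_empty: "schur n (\<lambda>_. 0) x = 1"
proof -
  have "ssyt n (\<lambda>_. 0) = {\<lambda>_. undefined}" by (auto simp: ssyt_def cells_def)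
  then show ?thesis by (simp add: schur_def cells_def)
qed

section \<open>Tableaux and Gelfand-Tsetlin patterns\<close>

text \<open>Removing the top row gives patterns the same recursion as the branching rule gives Schur
  polynomials.\<close>

lemma sum_gt_patterns_Suc:
  assumes supp: "\<And>i. i > n \<Longrightarrow> \<mu> i = 0"
  shows "(\<Sum>g\<in>gt_patterns (Suc n) \<mu>. F g)
    = (\<Sum>\<nu>\<in>interlacing n \<mu>. \<Sum>h\<in>gt_patterns n \<nu>. F (\<lambda>(k, i). if k = Suc n then \<mu> i else h (k, i)))"
proof -
  define ext where "ext h = (\<lambda>(k, i). if k = Suc n then \<mu> i else h (k, i))" for h :: "nat \<times> nat \<Rightarrow> nat"
  define res where "res g = (\<lambda>(k, i). if k = Suc n then 0 else g (k, i))" for g :: "nat \<times> nat \<Rightarrow> nat"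
  have top: "(\<lambda>i. g (n, i)) \<in> interlacing n \<mu>" if g: "g \<in> gt_patterns (Suc n) \<mu>" for g
  proof -
    have "g (n, i) \<le> \<mu> i" "\<mu> (Suc i) \<le> g (n, i)" for i using g by (auto simp: gt_patterns_def)
    then show ?thesis using gt_patterns_zero[OF g] by (auto simp: interlacing_def)
  qed
  have "(\<Sum>g\<in>gt_patterns (Suc n) \<mu>. F g) = (\<Sum>(\<nu>, h)\<in>(SIGMA \<nu>:interlacing n \<mu>. gt_patterns n \<nu>). F (ext h))"
  proof (rule sum.reindex_bij_witness[where i = "\<lambda>(\<nu>, h). ext h" and j = "\<lambda>g. (\<lambda>i. g (n, i), res g)"])
    fix g assume g: "g \<in> gt_patterns (Suc n) \<mu>"
    have e: "ext (res g) = g" using g by (auto simp: ext_def res_def gt_patterns_def fun_eq_iff)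
    then show "(case (\<lambda>i. g (n, i), res g) of (\<nu>, h) \<Rightarrow> ext h) = g" by simp
    show "(case (\<lambda>i. g (n, i), res g) of (\<nu>, h) \<Rightarrow> F (ext h)) = F g" by (simp add: e)
    have "res g \<in> gt_patterns n (\<lambda>i. g (n, i))"
      using g by (auto simp: res_def gt_patterns_def)
    then show "(\<lambda>i. g (n, i), res g) \<in> (SIGMA \<nu>:interlacing n \<mu>. gt_patterns n \<nu>)" using top[OF g] by simp
  next
    fix p assume "p \<in> (SIGMA \<nu>:interlacing n \<mu>. gt_patterns n \<nu>)"
    then obtain \<nu> h where p: "p = (\<nu>, h)" and \<nu>: "\<nu> \<in> interlacing n \<mu>" and h: "h \<in> gt_patterns n \<nu>" by auto
    have "res (ext h) = h" using h by (auto simp: ext_def res_def gt_patterns_def fun_eq_iff)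
    moreover have "(\<lambda>i. ext h (n, i)) = \<nu>" using h by (auto simp: ext_def gt_patterns_def)
    ultimately show "(\<lambda>i. (case p of (\<nu>, h) \<Rightarrow> ext h) (n, i), res (case p of (\<nu>, h) \<Rightarrow> ext h)) = p" by (simp add: p)
    have "\<mu> (Suc i) \<le> \<nu> i" for i using \<nu> supp[of "Suc i"] by (cases "i < n") (auto simp: interlacing_def)
    then have "ext h \<in> gt_patterns (Suc n) \<mu>"
      using h interlacing_le[OF \<nu>] by (auto simp: ext_def gt_patterns_def less_Suc_eq)
    then show "(case p of (\<nu>, h) \<Rightarrow> ext h) \<in> gt_patterns (Suc n) \<mu>" by (simp add: p)
  qed
  also have "\<dots> = (\<Sum>\<nu>\<in>interlacing n \<mu>. \<Sum>h\<in>gt_patterns n \<nu>. F (ext h))"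
    by (rule sum.Sigma[symmetric]) (simp_all add: finite_interlacing finite_gt_patterns)
  finally show ?thesis by (simp add: ext_def)
qed

text \<open>An entry \<open>T c\<close> is counted by \<open>N - T c\<close> of the rows of the Gelfand-Tsetlin pattern of \<open>T\<close>
  (extended by copies of the top row up to level \<open>N\<close>).\<close>

lemma schur_powers_eq_sum_gt_patterns:
  assumes "antimono \<mu>" and "\<And>i. i \<ge> n \<Longrightarrow> \<mu> i = 0" and "n \<le> Suc N"
  shows "schur n \<mu> (\<lambda>i. z ^ (N - i)) = (\<Sum>g\<in>gt_patterns n \<mu>. z ^ (gt_degree n g + (Suc N - n) * (\<Sum>i<n. \<mu> i)))"
  using assms
proof (induction n arbitrary: \<mu>)
  case 0
  then have mu: "\<mu> = (\<lambda>_. 0)" by auto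
  have "gt_patterns 0 \<mu> = {\<lambda>_. 0}"
    by (auto simp: gt_patterns_def mu fun_eq_iff) (metis gr0I)
  then show ?case by (simp add: mu schur_empty gt_degree_def)
next
  case (Suc n)
  have IH: "schur n \<nu> (\<lambda>i. z ^ (N - i)) = (\<Sum>h\<in>gt_patterns n \<nu>. z ^ (gt_degree n h + (Suc N - n) * (\<Sum>i<n. \<nu> i)))"
    if \<nu>: "\<nu> \<in> interlacing n \<mu>" for \<nu>
    using that Suc.prems by (intro Suc.IH interlacing_antimono[OF \<nu>]) (auto simp: interlacing_def)
  \<comment> \<open>The new entries weigh \<open>N - n\<close> each, and one of the
    \<open>Suc N - n\<close> copies of the size of \<open>\<nu>\<close> becomes row \<open>n\<close>
    in the degree.\<close>
  have expo: "gt_degree n h + (Suc N - n) * (\<Sum>i<n. \<nu> i) + (N - n) * ((\<Sum>i<Suc n. \<mu> i) - (\<Sum>i<n. \<nu> i))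
     = gt_degree (Suc n) (\<lambda>(k, i). if k = Suc n then \<mu> i else h (k, i)) + (Suc N - Suc n) * (\<Sum>i<Suc n. \<mu> i)"
    if \<nu>: "\<nu> \<in> interlacing n \<mu>" and h: "h \<in> gt_patterns n \<nu>" for \<nu> h
  proof -
    have "gt_degree (Suc n) (\<lambda>(k, i). if k = Suc n then \<mu> i else h (k, i)) = gt_degree n h + (\<Sum>i<n. \<nu> i)"
      using h by (simp add: gt_degree_def gt_patterns_def)
    moreover have "(\<Sum>i<n. \<nu> i) \<le> (\<Sum>i<Suc n. \<mu> i)"
      by (rule order_trans[OF sum_mono[of _ _ \<mu>]]) (use interlacing_le[OF \<nu>] in auto)
    then obtain e where e: "(\<Sum>i<Suc n. \<mu> i) = (\<Sum>i<n. \<nu> i) + e" using le_Suc_ex by blast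
    moreover have "Suc N - n = Suc (N - n)" using Suc.prems(3) by (simp add: Suc_diff_le)
    ultimately show ?thesis by (simp only: diff_Suc_Suc) (simp add: algebra_simps)
  qed
  have "schur (Suc n) \<mu> (\<lambda>i. z ^ (N - i))
    = (\<Sum>\<nu>\<in>interlacing n \<mu>. (\<Sum>h\<in>gt_patterns n \<nu>. z ^ (gt_degree n h + (Suc N - n) * (\<Sum>i<n. \<nu> i)))
        * (z ^ (N - n)) ^ ((\<Sum>i<Suc n. \<mu> i) - (\<Sum>i<n. \<nu> i)))"
    using Suc.prems by (subst schur_Suc) (auto simp: IH)
  also have "\<dots> = (\<Sum>\<nu>\<in>interlacing n \<mu>. \<Sum>h\<in>gt_patterns n \<nu>.
      z ^ (gt_degree n h + (Suc N - n) * (\<Sum>i<n. \<nu> i) + (N - n) * ((\<Sum>i<Suc n. \<mu> i) - (\<Sum>i<n. \<nu> i))))"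
    by (simp only: sum_distrib_right power_mult[symmetric] power_add[symmetric])
  also have "\<dots> = (\<Sum>g\<in>gt_patterns (Suc n) \<mu>. z ^ (gt_degree (Suc n) g + (Suc N - Suc n) * (\<Sum>i<Suc n. \<mu> i)))"
    using Suc.prems by (subst sum_gt_patterns_Suc) (auto simp: expo simp del: sum.lessThan_Suc intro!: sum.cong)
  finally show ?case .
qed

section \<open>Alternants\<close>

definition alternant :: "nat \<Rightarrow> (nat \<Rightarrow> nat) \<Rightarrow> (nat \<Rightarrow> 'a) \<Rightarrow> 'a::comm_ring_1" where
  "alternant n l x = det (mat n n (\<lambda>(j, i). x i ^ l j))"

lemma alternant_cong: "(\<And>j. j < n \<Longrightarrow> l j = l' j) \<Longrightarrow> (\<And>j. j < n \<Longrightarrow> x j = x' j) \<Longrightarrow> alternant n l x = alternant n l' x'"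
  unfolding alternant_def by (intro arg_cong[of _ _ det] eq_matI) auto

lemma alternant_Leibniz:
  "alternant n l x = (\<Sum>p | p permutes {..<n}. signof p * (\<Prod>j<n. x (p j) ^ l j))"
proof -
  have "alternant n l x = (\<Sum>p | p permutes {0..<n}. signof p * (\<Prod>j=0..<n. mat n n (\<lambda>(j, i). x i ^ l j) $$ (j, p j)))"
    unfolding alternant_def by (rule det_def') simp
  also have "\<dots> = (\<Sum>p | p permutes {0..<n}. signof p * (\<Prod>j=0..<n. x (p j) ^ l j))"
    by (intro sum.cong refl arg_cong2[where f = "(*)"] prod.cong) (auto dest: permutes_in_image)
  finally show ?thesis by (simp add: atLeast0LessThan)
qed

lemma alternant_permute:
  assumes p: "p permutes {..<n}"
  shows "alternant n l (x \<circ> p) = signof p * alternant n l x"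
proof -
  let ?A = "mat n n (\<lambda>(i, j). x i ^ l j)"
  have tr: "alternant n l y = det (mat n n (\<lambda>(i, j). y i ^ l j))" for y :: "nat \<Rightarrow> 'a"
  proof -
    have "mat n n (\<lambda>(j, i). y i ^ l j) = transpose_mat (mat n n (\<lambda>(i, j). y i ^ l j))" by (intro eq_matI) auto
    then show ?thesis unfolding alternant_def by (simp only: det_transpose[OF mat_carrier])
  qed
  have "det (mat n n (\<lambda>(i, j). ?A $$ (p i, j))) = signof p * det ?A"
    using p by (intro det_permute_rows) (auto simp: atLeast0LessThan)
  also have "mat n n (\<lambda>(i, j). ?A $$ (p i, j)) = mat n n (\<lambda>(i, j). (x \<circ> p) i ^ l j)"
    using permutes_in_image[OF p] by (intro eq_matI) auto
  finally show ?thesis by (simp only: tr)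
qed

lemma power_diff_telescope:
  fixes x y :: "'a::comm_ring_1"
  assumes "a \<le> b"
  shows "x ^ b - y ^ (b - a) * x ^ a = (x - y) * (\<Sum>k\<in>{a..<b}. x ^ k * y ^ (b - 1 - k))"
proof -
  have "x ^ b - y ^ (b - a) * x ^ a = x ^ a * (x ^ (b - a) - y ^ (b - a))"
    using assms by (simp add: algebra_simps flip: power_add)
  also have "\<dots> = (x - y) * (\<Sum>i<b - a. x ^ (i + a) * y ^ (b - a - Suc i))"
    unfolding power_diff_sumr2 by (simp add: sum_distrib_left power_add mult_ac)
  also have "(\<Sum>i<b - a. x ^ (i + a) * y ^ (b - a - Suc i)) = (\<Sum>k\<in>{a..<b}. x ^ k * y ^ (b - 1 - k))"
    by (rule sum.reindex_bij_witness[where i = "\<lambda>k. k - a" and j = "\<lambda>i. i + a"]) (use assms in \<open>auto simp: add.commute\<close>)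
  finally show ?thesis .
qed

text \<open>Subtracting suitable multiples of each row from the previous one clears the last column, so that
  \<open>x n\<close> splits off; expanding the geometric sums multilinearly gives the exponents interlacing \<open>l\<close>.\<close>

lemma alternant_Suc:
  assumes l: "\<And>j. j < n \<Longrightarrow> l (Suc j) \<le> l j"
  shows "alternant (Suc n) l x = x n ^ l n * (\<Prod>i<n. x i - x n) *
    (\<Sum>f\<in>(\<Pi>\<^sub>E j\<in>{..<n}. {l (Suc j)..<l j}). alternant n f x * (\<Prod>j<n. x n ^ (l j - 1 - f j)))"
proof -
  define A where "A = mat (Suc n) (Suc n) (\<lambda>(j, i). x i ^ l j)"
  define U where "U = mat (Suc n) (Suc n) (\<lambda>(j, k). if k = j then 1 else if k = Suc j then - (x n ^ (l j - l (Suc j))) else 0)"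
  define s where "s j i = (\<Sum>k\<in>{l (Suc j)..<l j}. x i ^ k * x n ^ (l j - 1 - k))" for j i
  define B where "B = mat (Suc n) (Suc n) (\<lambda>(j, i). if j = n then x i ^ l n else (x i - x n) * s j i)"
  have [simp]: "A \<in> carrier_mat (Suc n) (Suc n)" "U \<in> carrier_mat (Suc n) (Suc n)" "B \<in> carrier_mat (Suc n) (Suc n)"
    by (simp_all add: A_def U_def B_def)
  have detU: "det U = 1"
    by (subst det_upper_triangular[where n = "Suc n"])
      (auto simp: U_def prod_list_diag_prod upper_triangular_def)
  have UA: "U * A = B"
  proof (rule eq_matI)
    fix j i assume "j < dim_row B" "i < dim_col B"
    then have ji: "j < Suc n" "i < Suc n" by (auto simp: B_def)
    have "(U * A) $$ (j, i) = (\<Sum>k<Suc n. U $$ (j, k) * A $$ (k, i))"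
      using ji by (simp add: A_def U_def scalar_prod_def atLeast0LessThan)
    also have "\<dots> = (\<Sum>k<Suc n. (if k = j then x i ^ l j else 0)
        + (if k = Suc j then - (x n ^ (l j - l (Suc j))) * x i ^ l (Suc j) else 0))"
      using ji by (intro sum.cong refl) (auto simp: U_def A_def)
    also have "\<dots> = x i ^ l j + (if j < n then - (x n ^ (l j - l (Suc j))) * x i ^ l (Suc j) else 0)"
      using ji unfolding sum.distrib by (simp only: sum.delta finite_lessThan lessThan_iff) simp
    also have "\<dots> = B $$ (j, i)"
      using ji power_diff_telescope[OF l, of j "x i" "x n"] by (auto simp: B_def s_def less_Suc_eq)
    finally show "(U * A) $$ (j, i) = B $$ (j, i)" .
  qed (simp_all add: A_def B_def U_def)
  have "alternant (Suc n) l x = det U * det A" by (simp add: alternant_def A_def detU)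
  also have "\<dots> = det B" by (subst det_mult[symmetric, where n = "Suc n"]) (simp_all add: UA)
  \<comment> \<open>The last column of \<open>B\<close> vanishes above its bottom entry, as
    \<open>x n - x n = 0\<close>.\<close>
  also have "\<dots> = (\<Sum>j<Suc n. B $$ (j, n) * cofactor B j n)"
    by (rule laplace_expansion_column) simp_all
  also have "\<dots> = x n ^ l n * det (mat_delete B n n)"
    by (simp add: B_def cofactor_def flip: mult_2)
  also have "mat_delete B n n = mat n n (\<lambda>(j, i). (x i - x n) * s j i)"
    by (intro eq_matI) (auto simp: mat_delete_def B_def)
  also have "det \<dots> = (\<Sum>p | p permutes {..<n}. signof p * (\<Prod>j<n. (x (p j) - x n) * s j (p j)))"
    by (subst det_def'[of _ n])
      (auto simp: atLeast0LessThan intro!: sum.cong arg_cong2[where f = "(*)"] prod.cong dest: permutes_in_image)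
  also have "\<dots> = (\<Sum>p | p permutes {..<n}. signof p * ((\<Prod>i<n. x i - x n) *
      (\<Sum>f\<in>(\<Pi>\<^sub>E j\<in>{..<n}. {l (Suc j)..<l j}). \<Prod>j<n. x (p j) ^ f j * x n ^ (l j - 1 - f j))))"
  proof (intro sum.cong refl arg_cong2[where f = "(*)"])
    fix p assume "p \<in> {p. p permutes {..<n}}"
    then have "(\<Prod>j<n. x (p j) - x n) = (\<Prod>i<n. x i - x n)"
      using prod.permute[of p "{..<n}" "\<lambda>i. x i - x n"] by (simp add: comp_def)
    then show "(\<Prod>j<n. (x (p j) - x n) * s j (p j)) = (\<Prod>i<n. x i - x n) *
      (\<Sum>f\<in>(\<Pi>\<^sub>E j\<in>{..<n}. {l (Suc j)..<l j}). \<Prod>j<n. x (p j) ^ f j * x n ^ (l j - 1 - f j))"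
      unfolding s_def prod.distrib by (simp add: prod_sum_PiE flip: prod.distrib)
  qed
  also have "\<dots> = (\<Prod>i<n. x i - x n) * (\<Sum>p | p permutes {..<n}. \<Sum>f\<in>(\<Pi>\<^sub>E j\<in>{..<n}. {l (Suc j)..<l j}).
      signof p * (\<Prod>j<n. x (p j) ^ f j) * (\<Prod>j<n. x n ^ (l j - 1 - f j)))"
    by (simp add: sum_distrib_left prod.distrib mult_ac)
  also have "(\<Sum>p | p permutes {..<n}. \<Sum>f\<in>(\<Pi>\<^sub>E j\<in>{..<n}. {l (Suc j)..<l j}).
      signof p * (\<Prod>j<n. x (p j) ^ f j) * (\<Prod>j<n. x n ^ (l j - 1 - f j)))
     = (\<Sum>f\<in>(\<Pi>\<^sub>E j\<in>{..<n}. {l (Suc j)..<l j}). alternant n f x * (\<Prod>j<n. x n ^ (l j - 1 - f j)))"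
    by (subst sum.swap) (simp add: alternant_Leibniz sum_distrib_right)
  finally show ?thesis by (simp add: mult.assoc)
qed

section \<open>The bialternant formula and its consequences\<close>

text \<open>Both sides obey the same recursion: for \<open>l = \<mu> + rho\<close>, the exponents in
  the half-open ranges of \<open>alternant_Suc\<close> are exactly \<open>\<nu> + rho n\<close> with
  \<open>\<nu>\<close> interlacing \<open>\<mu>\<close>. The denominator is cleared so that the
  formula holds in every commutative ring.\<close>

lemma schur_times_Vandermonde:
  assumes "antimono \<mu>" and "\<And>i. i \<ge> n \<Longrightarrow> \<mu> i = 0"
  shows "schur n \<mu> x * (\<Prod>j<n. \<Prod>i<j. x i - x j) = alternant n (\<lambda>i. \<mu> i + rho n i) x"
  using assms
proof (induction n arbitrary: \<mu>)
  case 0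
  then have "\<mu> = (\<lambda>_. 0)" by auto
  then show ?case by (simp add: schur_empty alternant_def)
next
  case (Suc n)
  define l where "l i = \<mu> i + rho (Suc n) i" for i
  have l_Suc: "l (Suc j) \<le> l j" for j
    using Suc.prems(1) by (auto simp: l_def rho_def antimono_def intro!: add_mono)
  define \<phi> where "\<phi> \<nu> = (\<lambda>j\<in>{..<n}. \<nu> j + rho n j)" for \<nu> :: "nat \<Rightarrow> nat"
  have "(\<Sum>f\<in>(\<Pi>\<^sub>E j\<in>{..<n}. {l (Suc j)..<l j}). alternant n f x * (\<Prod>j<n. x n ^ (l j - 1 - f j)))
    = (\<Sum>\<nu>\<in>interlacing n \<mu>. alternant n (\<lambda>i. \<nu> i + rho n i) x * (\<Prod>j<n. x n ^ (\<mu> j - \<nu> j)))"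
  proof (rule sum.reindex_bij_witness[where i = \<phi> and j = "\<lambda>f i. if i < n then f i - rho n i else 0"])
    fix f assume f: "f \<in> (\<Pi>\<^sub>E j\<in>{..<n}. {l (Suc j)..<l j})"
    have rng: "\<mu> (Suc j) + rho n j \<le> f j" "f j < \<mu> j + rho n j + 1" if "j < n" for j
      using PiE_mem[OF f, of j] that by (auto simp: l_def rho_def)
    have ge: "rho n j \<le> f j" if "j < n" for j using rng(1)[OF that] by simp
    show "\<phi> (\<lambda>i. if i < n then f i - rho n i else 0) = f"
    proof
      fix i show "\<phi> (\<lambda>i. if i < n then f i - rho n i else 0) i = f i"
        using rng[of i] PiE_arb[OF f, of i] by (auto simp: \<phi>_def)
    qed
    show "(\<lambda>i. if i < n then f i - rho n i else 0) \<in> interlacing n \<mu>"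
      unfolding interlacing_def using rng by (auto simp: le_diff_conv2 le_diff_conv dest: add_leD2) (force, force)
    have "alternant n (\<lambda>i. (if i < n then f i - rho n i else 0) + rho n i) x = alternant n f x"
      using ge by (intro alternant_cong) auto
    moreover have "(\<Prod>j<n. x n ^ (\<mu> j - (if j < n then f j - rho n j else 0))) = (\<Prod>j<n. x n ^ (l j - 1 - f j))"
    proof (intro prod.cong refl arg_cong2[where f = "(^)"])
      fix j assume "j \<in> {..<n}"
      then have "l j = \<mu> j + rho n j + 1" "rho n j \<le> f j" "j < n" using rng(1)[of j] by (auto simp: l_def rho_def)
      then show "\<mu> j - (if j < n then f j - rho n j else 0) = l j - 1 - f j" by simp
    qed
    ultimately show "alternant n (\<lambda>i. (if i < n then f i - rho n i else 0) + rho n i) x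
        * (\<Prod>j<n. x n ^ (\<mu> j - (if j < n then f j - rho n j else 0)))
      = alternant n f x * (\<Prod>j<n. x n ^ (l j - 1 - f j))" by simp
  next
    fix \<nu> assume \<nu>: "\<nu> \<in> interlacing n \<mu>"
    show "(\<lambda>i. if i < n then \<phi> \<nu> i - rho n i else 0) = \<nu>"
      using \<nu> by (auto simp: \<phi>_def interlacing_def)
    show "\<phi> \<nu> \<in> (\<Pi>\<^sub>E j\<in>{..<n}. {l (Suc j)..<l j})"
    proof (rule PiE_I)
      fix j assume "j \<in> {..<n}"
      then have "l j = \<mu> j + rho n j + 1" "l (Suc j) = \<mu> (Suc j) + rho n j" "\<phi> \<nu> j = \<nu> j + rho n j"
        "\<mu> (Suc j) \<le> \<nu> j" "\<nu> j \<le> \<mu> j"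
        using \<nu> by (auto simp: l_def rho_def \<phi>_def interlacing_def)
      then show "\<phi> \<nu> j \<in> {l (Suc j)..<l j}" by simp
    qed (simp add: \<phi>_def)
  qed
  moreover have "alternant n (\<lambda>i. \<nu> i + rho n i) x = schur n \<nu> x * (\<Prod>j<n. \<Prod>i<j. x i - x j)"
    if \<nu>: "\<nu> \<in> interlacing n \<mu>" for \<nu>
    using \<nu> by (intro Suc.IH[symmetric] interlacing_antimono[OF \<nu>]) (simp add: interlacing_def)
  ultimately have "alternant (Suc n) l x = x n ^ l n * (\<Prod>i<n. x i - x n) *
      (\<Sum>\<nu>\<in>interlacing n \<mu>. schur n \<nu> x * (\<Prod>j<n. \<Prod>i<j. x i - x j) * (\<Prod>j<n. x n ^ (\<mu> j - \<nu> j)))"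
    by (simp add: alternant_Suc l_Suc)
  also have "\<dots> = (\<Prod>j<Suc n. \<Prod>i<j. x i - x j) * (\<Sum>\<nu>\<in>interlacing n \<mu>. schur n \<nu> x * (x n ^ l n * (\<Prod>j<n. x n ^ (\<mu> j - \<nu> j))))"
    by (simp add: sum_distrib_left mult_ac)
  also have "(\<Sum>\<nu>\<in>interlacing n \<mu>. schur n \<nu> x * (x n ^ l n * (\<Prod>j<n. x n ^ (\<mu> j - \<nu> j))))
     = (\<Sum>\<nu>\<in>interlacing n \<mu>. schur n \<nu> x * x n ^ ((\<Sum>i<Suc n. \<mu> i) - (\<Sum>i<n. \<nu> i)))"
  proof (intro sum.cong refl arg_cong2[where f = "(*)"])
    fix \<nu> assume \<nu>: "\<nu> \<in> interlacing n \<mu>"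
    have "(\<Sum>j<n. \<mu> j - \<nu> j) = (\<Sum>j<n. \<mu> j) - (\<Sum>j<n. \<nu> j)"
      by (rule sum_subtractf_nat) (rule interlacing_le[OF \<nu>])
    moreover have "(\<Sum>j<n. \<nu> j) \<le> (\<Sum>j<n. \<mu> j)" by (intro sum_mono interlacing_le[OF \<nu>])
    moreover have "l n = \<mu> n" by (simp add: l_def rho_def)
    ultimately show "x n ^ l n * (\<Prod>j<n. x n ^ (\<mu> j - \<nu> j)) = x n ^ ((\<Sum>i<Suc n. \<mu> i) - (\<Sum>i<n. \<nu> i))"
      by (simp add: power_sum[symmetric] power_add[symmetric] add.commute)
  qed
  also have "\<dots> = schur (Suc n) \<mu> x"
    using Suc.prems by (intro schur_Suc[symmetric]) auto
  finally show ?case by (simp add: l_def mult.commute)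
qed

lemma Vandermonde: "alternant n (rho n) x = (\<Prod>j<n. \<Prod>i<j. x i - x j)"
  using schur_times_Vandermonde[of "\<lambda>_. 0" n x] by (simp add: schur_empty antimono_def)

text \<open>A permutation multiplies both alternants by the same sign, and distinct variables make
  the Vandermonde product cancellable.\<close>

lemma schur_permute:
  fixes x :: "nat \<Rightarrow> 'a::idom"
  assumes "antimono \<mu>" and "\<And>i. i \<ge> n \<Longrightarrow> \<mu> i = 0" and "inj_on x {..<n}" and p: "p permutes {..<n}"
  shows "schur n \<mu> (x \<circ> p) = schur n \<mu> x"
proof -
  have a: "schur n \<mu> y * alternant n (rho n) y = alternant n (\<lambda>i. \<mu> i + rho n i) y" for y :: "nat \<Rightarrow> 'a"
    unfolding Vandermonde by (rule schur_times_Vandermonde[OF assms(1,2)])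
  have ne: "signof p * alternant n (rho n) x \<noteq> 0"
    using assms(3) by (auto simp: Vandermonde sign_def inj_on_def)
  have "schur n \<mu> (x \<circ> p) * (signof p * alternant n (rho n) x) = schur n \<mu> x * (signof p * alternant n (rho n) x)"
    using a[of "x \<circ> p"] a[of x] by (simp only: alternant_permute[OF p] mult.left_commute)
  then show ?thesis using ne by simp
qed

text \<open>With \<open>\<lambda> = 2\<mu> + \<rho>\<close> the numerator alternant of \<open>S\<^sub>\<lambda>(x)\<close> is that of \<open>S\<^sub>\<mu>\<close> at the squared variables.\<close>

lemma schur_double_plus_rho:
  fixes x :: "nat \<Rightarrow> 'a::idom"
  assumes mu: "antimono \<mu>" "\<And>i. i \<ge> n \<Longrightarrow> \<mu> i = 0" and x: "inj_on x {..<n}"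
  shows "schur n (\<lambda>i. 2 * \<mu> i + rho n i) x = schur n \<mu> (\<lambda>i. x i ^ 2) * (\<Prod>j<n. \<Prod>i<j. x i + x j)"
proof -
  let ?V = "\<Prod>j<n. \<Prod>i<j. x i - x j"
  have ne: "?V \<noteq> 0" using x by (auto simp: inj_on_def)
  have "schur n (\<lambda>i. 2 * \<mu> i + rho n i) x * ?V = alternant n (\<lambda>i. 2 * \<mu> i + rho n i + rho n i) x"
    using mu by (intro schur_times_Vandermonde)
      (auto simp: rho_def antimono_def intro!: add_mono)
  also have "\<dots> = alternant n (\<lambda>i. \<mu> i + rho n i) (\<lambda>i. x i ^ 2)"
    unfolding alternant_def by (intro arg_cong[of _ _ det] eq_matI) (auto simp flip: power_mult power_add simp: algebra_simps)
  also have "\<dots> = schur n \<mu> (\<lambda>i. x i ^ 2) * (\<Prod>j<n. \<Prod>i<j. x i ^ 2 - x j ^ 2)"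
    by (rule schur_times_Vandermonde[OF mu, symmetric])
  also have "(\<Prod>j<n. \<Prod>i<j. x i ^ 2 - x j ^ 2) = (\<Prod>j<n. \<Prod>i<j. x i + x j) * ?V"
    by (simp add: prod.distrib[symmetric] power2_eq_square algebra_simps)
  finally show ?thesis using ne by simp
qed

section \<open>The principal specialization\<close>

lemma partition_support:
  assumes "is_partition \<mu>" and "num_parts \<mu> \<le> n" and "n \<le> i"
  shows "\<mu> i = 0"
proof (rule ccontr)
  assume "\<mu> i \<noteq> 0"
  moreover have "\<mu> i \<le> \<mu> j" if "j \<le> i" for j
    using assms(1) that by (auto simp: is_partition_def dest: antimonoD)
  ultimately have "{..i} \<subseteq> {j. \<mu> j \<noteq> 0}" by fastforce
  then have "card {..i} \<le> num_parts \<mu>"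
    unfolding num_parts_def using assms(1) by (intro card_mono) (auto simp: is_partition_def)
  then show False using assms(2,3) by simp
qed

text \<open>This passes from the ascending powers of the theorem to the descending ones, for which
  the weight of a tableau is the degree of its pattern.\<close>

lemma schur_powers_rev:
  fixes z :: "'a::idom"
  assumes mu: "antimono \<mu>" "\<And>i. i \<ge> n \<Longrightarrow> \<mu> i = 0" and "inj_on (\<lambda>i. z ^ i) {..<n}"
  shows "schur n \<mu> (\<lambda>i. z ^ i) = schur n \<mu> (\<lambda>i. z ^ (n - 1 - i))"
proof -
  define p where "p i = (if i < n then n - 1 - i else i)" for i
  have "p permutes {..<n}"
    by (rule bij_imp_permutes, rule bij_betw_byWitness[where f' = p]) (auto simp: p_def)
  from schur_permute[OF assms this] have "schur n \<mu> (\<lambda>i. z ^ i) = schur n \<mu> ((\<lambda>i. z ^ i) \<circ> p)" by simp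
  also have "\<dots> = schur n \<mu> (\<lambda>i. z ^ (n - 1 - i))"
    unfolding schur_def
  proof (intro sum.cong refl prod.cong)
    fix T c assume "T \<in> ssyt n \<mu>" "c \<in> cells \<mu>"
    then have "T c < n" by (auto simp: ssyt_def)
    then show "((\<lambda>i. z ^ i) \<circ> p) (T c) = z ^ (n - 1 - T c)" by (simp add: p_def)
  qed
  finally show ?thesis .
qed

lemma inj_qvar_powers: "0 < m \<Longrightarrow> inj_on (\<lambda>i. (qvar ^ m) ^ i) A"
proof (rule inj_onI)
  fix i j assume "0 < m" "(qvar ^ m) ^ i = (qvar ^ m) ^ j"
  then have "degree (monom (1::int) (m * i)) = degree (monom (1::int) (m * j))"
    by (simp only: qvar_power monom_power power_one)
  then show "i = j" using \<open>0 < m\<close> by (simp add: degree_monom_eq)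
qed

text \<open>Since \<open>q ^ i + q ^ j = q ^ i * (1 + q ^ (j - i))\<close>, the pairs with
  \<open>j = Suc m\<close> contribute \<open>w m\<close> and the power
  \<open>Suc m choose 2\<close>; Pascal's rule accumulates these powers to a binomial coefficient
  over 3.\<close>

lemma prod_qvar_pair_sums:
  "(\<Prod>j<Suc m. \<Prod>i<j. qvar ^ i + qvar ^ j) = qvar ^ (Suc m choose 3) * (\<Prod>k<m. w k)"
proof (induction m)
  case (Suc m)
  have "(\<Prod>i<Suc m. qvar ^ i + qvar ^ Suc m) = (\<Prod>i<Suc m. qvar ^ i * (1 + qvar ^ (Suc m - i)))"
    by (intro prod.cong refl) (simp add: distrib_left flip: power_add)
  also have "\<dots> = qvar ^ (\<Sum>i<Suc m. i) * (\<Prod>i<Suc m. 1 + qvar ^ (Suc m - i))"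
    by (simp only: prod.distrib power_sum)
  also have "(\<Prod>i<Suc m. 1 + qvar ^ (Suc m - i)) = w m"
    unfolding w_def by (rule prod.reindex_bij_witness[where i = "\<lambda>i. Suc m - i" and j = "\<lambda>i. Suc m - i"]) auto
  also have "(\<Sum>i<Suc m. i) = Suc m choose 2"
    by (induction m) (simp_all add: numeral_2_eq_2)
  finally have "(\<Prod>j<Suc (Suc m). \<Prod>i<j. qvar ^ i + qvar ^ j)
     = qvar ^ (Suc m choose 3) * (\<Prod>k<m. w k) * (qvar ^ (Suc m choose 2) * w m)"
    using Suc.IH by (simp only: prod.lessThan_Suc[of _ "Suc m"])
  also have "\<dots> = qvar ^ ((Suc m choose 3) + (Suc m choose 2)) * (\<Prod>k<Suc m. w k)"
    by (simp add: power_add mult_ac)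
  also have "(Suc m choose 3) + (Suc m choose 2) = Suc (Suc m) choose 3"
    by (simp add: numeral_3_eq_3 numeral_2_eq_2)
  finally show ?case .
qed (simp add: numeral_3_eq_3)

lemma coeff_schur_qvar_squares:
  assumes mu: "antimono \<mu>" "\<And>i. i \<ge> n \<Longrightarrow> \<mu> i = 0" and "0 < n"
  shows "coeff (schur n \<mu> (\<lambda>i. qvar ^ (2 * i))) r =
    (if even r then int (card {g \<in> gt_patterns n \<mu>. gt_degree n g = r div 2}) else 0)"
proof -
  have "schur n \<mu> (\<lambda>i. qvar ^ (2 * i)) = schur n \<mu> (\<lambda>i. (qvar ^ 2) ^ (n - 1 - i))"
    unfolding power_mult by (rule schur_powers_rev[OF mu inj_qvar_powers]) simp_all
  also have "\<dots> = (\<Sum>g\<in>gt_patterns n \<mu>. (qvar ^ 2) ^ gt_degree n g)"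
    using schur_powers_eq_sum_gt_patterns[OF mu, where N = "n - 1" and z = "qvar ^ 2"] \<open>0 < n\<close> by simp
  also have "coeff \<dots> r = int (card {g \<in> gt_patterns n \<mu>. 2 * gt_degree n g = r})"
    unfolding power_mult[symmetric] by (rule coeff_sum_qvar_power[OF finite_gt_patterns])
  finally have eq: "coeff (schur n \<mu> (\<lambda>i. qvar ^ (2 * i))) r = int (card {g \<in> gt_patterns n \<mu>. 2 * gt_degree n g = r})" .
  show ?thesis
  proof (cases "even r")
    case True
    then have "{g \<in> gt_patterns n \<mu>. 2 * gt_degree n g = r} = {g \<in> gt_patterns n \<mu>. gt_degree n g = r div 2}" by auto
    then show ?thesis using True by (simp only: eq if_True)
  next
    case False
    then have "{g \<in> gt_patterns n \<mu>. 2 * gt_degree n g = r} = {}" by auto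
    then show ?thesis using False by (simp only: eq if_False card.empty of_nat_0)
  qed
qed

text \<open>Reversing the variables complements every tableau entry, so the symmetry of the Schur polynomial
  makes the counting function of the level sets palindromic.\<close>

lemma card_gt_level_symmetric:
  assumes mu: "antimono \<mu>" "\<And>i. i \<ge> n \<Longrightarrow> \<mu> i = 0" and "0 < n"
  defines "R \<equiv> (n - 1) * (\<Sum>i<n. \<mu> i)"
  shows "R < r \<Longrightarrow> card {g \<in> gt_patterns n \<mu>. gt_degree n g = r} = 0"
    and "r \<le> R \<Longrightarrow> card {g \<in> gt_patterns n \<mu>. gt_degree n g = r} = card {g \<in> gt_patterns n \<mu>. gt_degree n g = R - r}"
proof -
  define e where "e T = (\<Sum>c\<in>cells \<mu>. T c)" for T :: "nat \<times> nat \<Rightarrow> nat"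
  have fin_cells: "finite (cells \<mu>)" by (rule finite_cells[OF mu(2)])
  have fin: "finite (ssyt n \<mu>)"
  proof (rule finite_subset)
    show "ssyt n \<mu> \<subseteq> cells \<mu> \<rightarrow>\<^sub>E {..<n}" by (auto simp: ssyt_def)
  qed (simp add: finite_PiE fin_cells)
  have le: "e T \<le> R" and compl: "(\<Sum>c\<in>cells \<mu>. n - 1 - T c) = R - e T" if T: "T \<in> ssyt n \<mu>" for T
  proof -
    have Tc: "T c \<le> n - 1" if "c \<in> cells \<mu>" for c
      using that ssytD(1)[OF T, of "snd c" "fst c"] by (auto simp: cells_def)
    have tot: "(\<Sum>c\<in>cells \<mu>. n - 1) = R"
      using card_cells[of n \<mu>] mu(2) by (simp add: R_def)
    show "e T \<le> R" unfolding e_def tot[symmetric] by (rule sum_mono) (rule Tc)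
    show "(\<Sum>c\<in>cells \<mu>. n - 1 - T c) = R - e T"
      unfolding e_def tot[symmetric] by (rule sum_subtractf_nat) (rule Tc)
  qed
  have rev: "schur n \<mu> (\<lambda>i. qvar ^ i) = schur n \<mu> (\<lambda>i. qvar ^ (n - 1 - i))"
    using schur_powers_rev[OF mu, where z = qvar] inj_qvar_powers[of 1] by simp
  have "schur n \<mu> (\<lambda>i. qvar ^ (n - 1 - i)) = (\<Sum>g\<in>gt_patterns n \<mu>. qvar ^ gt_degree n g)"
    using schur_powers_eq_sum_gt_patterns[OF mu, where N = "n - 1" and z = qvar] \<open>0 < n\<close> by simp
  then have level: "int (card {g \<in> gt_patterns n \<mu>. gt_degree n g = r}) = coeff (schur n \<mu> (\<lambda>i. qvar ^ (n - 1 - i))) r" for r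
    by (simp only: coeff_sum_qvar_power finite_gt_patterns)
  \<comment> \<open>The level sizes are read off twice, with \<open>T\<close> at exponent
    \<open>R - e T\<close> for descending powers and at \<open>e T\<close> for ascending
    ones.\<close>
  have "schur n \<mu> (\<lambda>i. qvar ^ (n - 1 - i)) = (\<Sum>T\<in>ssyt n \<mu>. qvar ^ (R - e T))"
    unfolding schur_def by (intro sum.cong refl) (simp only: power_sum[symmetric] compl)
  then have A: "card {g \<in> gt_patterns n \<mu>. gt_degree n g = r} = card {T \<in> ssyt n \<mu>. R - e T = r}" for r
    using level[of r] by (simp only: coeff_sum_qvar_power fin of_nat_eq_iff)
  have "schur n \<mu> (\<lambda>i. qvar ^ i) = (\<Sum>T\<in>ssyt n \<mu>. qvar ^ e T)"
    unfolding schur_def by (intro sum.cong refl) (simp only: power_sum[symmetric] e_def)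
  then have B: "card {g \<in> gt_patterns n \<mu>. gt_degree n g = r} = card {T \<in> ssyt n \<mu>. e T = r}" for r
    using level[of r] by (simp only: rev[symmetric] coeff_sum_qvar_power fin of_nat_eq_iff)
  show "card {g \<in> gt_patterns n \<mu>. gt_degree n g = r} = 0" if "R < r"
  proof -
    have "e T \<noteq> r" if "T \<in> ssyt n \<mu>" for T using le[OF that] \<open>R < r\<close> by linarith
    then have "{T \<in> ssyt n \<mu>. e T = r} = {}" by blast
    then show ?thesis by (simp only: B card.empty)
  qed
  show "card {g \<in> gt_patterns n \<mu>. gt_degree n g = r} = card {g \<in> gt_patterns n \<mu>. gt_degree n g = R - r}" if "r \<le> R"
  proof -
    have "R - e T = r \<longleftrightarrow> e T = R - r" if "T \<in> ssyt n \<mu>" for T using le[OF that] \<open>r \<le> R\<close> by linarith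
    then have "{T \<in> ssyt n \<mu>. R - e T = r} = {T \<in> ssyt n \<mu>. e T = R - r}" by blast
    then show ?thesis by (simp only: A[of r] B[of "R - r"])
  qed
qed

theorem proposition3:
  fixes n :: nat and \<mu> :: "nat \<Rightarrow> nat"
  assumes "n \<ge> 2" and "is_partition \<mu>" and "num_parts \<mu> \<le> n"
  shows "schur n (\<lambda>i. 2 * \<mu> i + rho n i) (\<lambda>i. qvar ^ i)
           = (qvar ^ (n choose 3) * (1 + qvar) * schur n \<mu> (\<lambda>i. qvar ^ (2 * i)))
             * (\<Prod>k=1..n-2. w k)
         \<and> symmetric_unimodal (qvar ^ (n choose 3) * (1 + qvar) * schur n \<mu> (\<lambda>i. qvar ^ (2 * i)))
         \<and> (\<forall>k\<in>{1..n-2}. symmetric_unimodal (w k))"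
proof (intro conjI ballI)
  have mu: "antimono \<mu>" "\<And>i. i \<ge> n \<Longrightarrow> \<mu> i = 0"
    using assms partition_support by (auto simp: is_partition_def)
  obtain m where n: "n = Suc (Suc m)" using \<open>n \<ge> 2\<close> by (metis add_2_eq_Suc le_Suc_ex)
  \<comment> \<open>The pair product runs from \<open>w 0\<close>, and this extra factor is the
    \<open>1 + q\<close> attached to \<open>schur n \<mu>\<close>.\<close>
  have w0: "w 0 = 1 + qvar" by (simp add: w_def)
  have "{..<Suc m} = insert 0 {1..m}" by auto
  then have split: "(\<Prod>k<Suc m. w k) = (1 + qvar) * (\<Prod>k=1..m. w k)" using w0 by simp
  have "schur n (\<lambda>i. 2 * \<mu> i + rho n i) (\<lambda>i. qvar ^ i)
    = schur n \<mu> (\<lambda>i. (qvar ^ i) ^ 2) * (\<Prod>j<n. \<Prod>i<j. qvar ^ i + qvar ^ j)"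
    using inj_qvar_powers[of 1] by (intro schur_double_plus_rho[OF mu]) simp_all
  also have "(\<Prod>j<n. \<Prod>i<j. qvar ^ i + qvar ^ j) = qvar ^ (n choose 3) * ((1 + qvar) * (\<Prod>k=1..n-2. w k))"
    unfolding n prod_qvar_pair_sums split by simp
  also have "(\<lambda>i. (qvar ^ i) ^ 2) = (\<lambda>i. qvar ^ (2 * i))"
    by (simp add: mult.commute flip: power_mult)
  finally show "schur n (\<lambda>i. 2 * \<mu> i + rho n i) (\<lambda>i. qvar ^ i)
     = (qvar ^ (n choose 3) * (1 + qvar) * schur n \<mu> (\<lambda>i. qvar ^ (2 * i))) * (\<Prod>k=1..n-2. w k)"
    by (simp only: mult_ac)
  have "0 < n" using n by simp
  show "symmetric_unimodal (qvar ^ (n choose 3) * (1 + qvar) * schur n \<mu> (\<lambda>i. qvar ^ (2 * i)))"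
  proof (rule symmetric_unimodal_double[where R = "(n - 1) * (\<Sum>i<n. \<mu> i)"
        and a = "\<lambda>r. int (card {g \<in> gt_patterns n \<mu>. gt_degree n g = r})"], unfold of_nat_eq_0_iff of_nat_eq_iff of_nat_le_iff)
    fix r
    let ?c = "\<lambda>r. card {g \<in> gt_patterns n \<mu>. gt_degree n g = r}" and ?R = "(n - 1) * (\<Sum>i<n. \<mu> i)"
    show "?R < r \<Longrightarrow> ?c r = 0" by (rule card_gt_level_symmetric(1)[OF mu \<open>0 < n\<close>])
    show "r \<le> ?R \<Longrightarrow> ?c r = ?c (?R - r)" by (rule card_gt_level_symmetric(2)[OF mu \<open>0 < n\<close>])
    show "2 * r < ?R \<Longrightarrow> ?c r \<le> ?c (Suc r)" by (rule card_gt_level_mono)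
    show "coeff (schur n \<mu> (\<lambda>i. qvar ^ (2 * i))) r = (if even r then int (?c (r div 2)) else 0)"
      by (rule coeff_schur_qvar_squares[OF mu \<open>0 < n\<close>])
  qed
  show "symmetric_unimodal (w k)" for k by (rule symmetric_unimodal_w)
qed

end
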